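(* Let $K$ be a finite extension of $\mathbb{F}_q(t)$, $q$ a power of a prime $p$, and let $P$ be a place of $K$. For every Kodaira type $\mathfrak{r}$, every positive integer $n$ and every nonnegative integer $k$, \[ \delta_K(\mathfrak{r},n,k;P)=\frac{1}{Q_P^{10k}}\,\delta_K(\mathfrak{r},n,0;P). \]
   Context: $K_P$ is the completion of $K$ at $P$, $R_P$ its valuation ring, $\pi_P$ a uniformizer, $v_P$ the normalized valuation, and $Q_P=|R_P/\pi_PR_P|$. $G_P$ is the set of Weierstrass equations $y^2+a_1xy+a_3y=x^3+a_2x^2+a_4x+a_6$ with $a_1,a_2,a_3,a_4,a_6\in R_P$, identified with $R_P^5$; an element of $G_P$ is called an elliptic curve if its discriminant is nonzero. $\mu_P$ denotes the Haar measure on $K_P^5$ normalized by $\mu_P(R_P^5)=1$. For an elliptic curve $E\in G_P$, Tate's algorithm (in the form of Silverman, Advanced Topics in the Arithmetic of Elliptic Curves, IV.9) either terminates in one of its steps 1–10, giving the Kodaira type and Tamagawa number $c_P=[E(K_P):E_0(K_P)]$, or reaches its final step, where after a change of coordinates the coefficients satisfy $\pi_P^i\mid a_i$ for $i\in\{1,2,3,4,6\}$, the equation is replaced by the one with coefficients $a_i/\pi_P^i$, and the algorithm restarts; $N_P(E)$ denotes the number of iterations of Tate's algorithm completed (i.e., the number of such restarts) when it is applied to $E$. For a Kodaira type $\mathfrak{r}$, positive integer $n$ and integer $k\ge 0$, $\delta_K(\mathfrak{r},n,k;P)$ is the $\mu_P$-measure of the set of elliptic curves $E\in G_P$ of Kodaira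 type $\mathfrak{r}$ over $K_P$ with Tamagawa number $n$ and $N_P(E)=k$. *)

theory Defs
  imports
    "HOL-Analysis.Analysis"
    "HOL-Computational_Algebra.Polynomial"
    "HOL-Computational_Algebra.Fraction_Field"
    "HOL-Algebra.Coset"
begin

section \<open>Function fields, places and completions\<close>

text \<open>
  The vector space laws for the scaling \<open>(c, x) \<mapsto> i c * x\<close> say exactly that \<open>i\<close> is a
  (unital, hence injective) ring homomorphism; the existence of a finite basis says that the
  extension has finite degree.
\<close>

definition finite_field_extension :: "('f::field \<Rightarrow> 'k::field) \<Rightarrow> bool" where
  "finite_field_extension i \<longleftrightarrow> (\<exists>B. finite_dimensional_vector_space (\<lambda>c x. i c * x) B)"

text \<open>
  Normalized discrete valuations with value group the integers. The value at 0, mathematically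
  infinite, is left unspecified. The places of a global function field are its normalized
  discrete valuations (they are trivial on the finite constant field automatically).
\<close>

definition normalized_valuation :: "('a::field \<Rightarrow> int) \<Rightarrow> bool" where
  "normalized_valuation v \<longleftrightarrow>
     (\<forall>x y. x \<noteq> 0 \<longrightarrow> y \<noteq> 0 \<longrightarrow> v (x * y) = v x + v y) \<and>
     (\<forall>x y. x \<noteq> 0 \<longrightarrow> y \<noteq> 0 \<longrightarrow> x + y \<noteq> 0 \<longrightarrow> min (v x) (v y) \<le> v (x + y)) \<and>
     (\<exists>x. x \<noteq> 0 \<and> v x = 1)"

text \<open>The ideal generated by the \<open>i\<close>-th power of a uniformizer; \<open>i = 0\<close> gives the valuation ring.\<close>

definition val_ideal :: "('a::field \<Rightarrow> int) \<Rightarrow> nat \<Rightarrow> 'a set" where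
  "val_ideal v i = {x. x = 0 \<or> int i \<le> v x}"

abbreviation val_ring :: "('a::field \<Rightarrow> int) \<Rightarrow> 'a set" where
  "val_ring v \<equiv> val_ideal v 0"

definition residue_card :: "('a::field \<Rightarrow> int) \<Rightarrow> nat" where
  "residue_card v =
     card (val_ring v // {(x, y). x \<in> val_ring v \<and> y \<in> val_ring v \<and> x - y \<in> val_ideal v 1})"

definition val_abs :: "('a::field \<Rightarrow> int) \<Rightarrow> 'a \<Rightarrow> real" where
  "val_abs v x = (if x = 0 then 0 else real (residue_card v) powi (- v x))"

text \<open>
  The field \<open>'l\<close> with valuation \<open>w\<close> and embedding \<open>e\<close> is the completion of \<open>'k\<close> at \<open>v\<close>. The
  distance function of \<open>'l\<close> (hence also its topology and its Borel sets) is the one of the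
  normalized absolute value; completeness itself is part of the class constraint
  \<open>complete_space\<close>.
\<close>

definition is_completion ::
    "('k::field \<Rightarrow> int) \<Rightarrow> ('k \<Rightarrow> 'l::{field, complete_space}) \<Rightarrow> ('l \<Rightarrow> int) \<Rightarrow> bool" where
  "is_completion v e w \<longleftrightarrow>
     normalized_valuation w \<and>
     (\<forall>x y. dist x y = val_abs w (x - y)) \<and>
     e 1 = 1 \<and> (\<forall>x y. e (x + y) = e x + e y) \<and> (\<forall>x y. e (x * y) = e x * e y) \<and>
     (\<forall>x. x \<noteq> 0 \<longrightarrow> w (e x) = v x) \<and>
     closure (range e) = UNIV"

text \<open>
  Haar measures on the Borel sets. No regularity condition is imposed: it is automatic on second
  countable locally compact groups, such as finite powers of a completion of a global field.
\<close>

definition haar_measure :: "'a::{topological_space, ab_group_add} measure \<Rightarrow> bool" where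
  "haar_measure M \<longleftrightarrow>
     sets M = sets borel \<and>
     (\<forall>x. \<forall>A \<in> sets borel. emeasure M ((+) x ` A) = emeasure M A) \<and>
     (\<forall>C. compact C \<longrightarrow> emeasure M C < \<infinity>) \<and>
     (\<forall>U. open U \<longrightarrow> U \<noteq> {} \<longrightarrow> emeasure M U > 0)"

section \<open>Weierstrass equations\<close>

text \<open>
  The tuple \<open>(a1, a2, a3, a4, a6)\<close> stands for
  \<open>y^2 + a1 x y + a3 y = x^3 + a2 x^2 + a4 x + a6\<close>.
\<close>

type_synonym 'a weq = "'a \<times> 'a \<times> 'a \<times> 'a \<times> 'a"

fun b2 :: "'a::field weq \<Rightarrow> 'a" where
  "b2 (a1, a2, a3, a4, a6) = a1^2 + 4 * a2"

fun b4 :: "'a::field weq \<Rightarrow> 'a" where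
  "b4 (a1, a2, a3, a4, a6) = 2 * a4 + a1 * a3"

fun b6 :: "'a::field weq \<Rightarrow> 'a" where
  "b6 (a1, a2, a3, a4, a6) = a3^2 + 4 * a6"

fun b8 :: "'a::field weq \<Rightarrow> 'a" where
  "b8 (a1, a2, a3, a4, a6) = a1^2 * a6 + 4 * a2 * a6 - a1 * a3 * a4 + a2 * a3^2 - a4^2"

definition weq_disc :: "'a::field weq \<Rightarrow> 'a" where
  "weq_disc E = - ((b2 E)^2 * b8 E) - 8 * (b4 E)^3 - 27 * (b6 E)^2 + 9 * b2 E * b4 E * b6 E"

text \<open>
  The equation in the coordinates \<open>(x', y')\<close> with \<open>x = u^2 x' + r\<close> and
  \<open>y = u^3 y' + s u^2 x' + t\<close>.
\<close>

fun change_coords :: "'a::field \<Rightarrow> 'a \<Rightarrow> 'a \<Rightarrow> 'a \<Rightarrow> 'a weq \<Rightarrow> 'a weq" where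
  "change_coords u r s t (a1, a2, a3, a4, a6) =
     ((a1 + 2 * s) / u,
      (a2 - s * a1 + 3 * r - s^2) / u^2,
      (a3 + r * a1 + 2 * t) / u^3,
      (a4 - s * a3 + 2 * r * a2 - (t + r * s) * a1 + 3 * r^2 - 2 * s * t) / u^4,
      (a6 + r * a4 + r^2 * a2 + r^3 - t * a3 - t^2 - r * t * a1) / u^6)"

text \<open>\<open>divisible v (n1, n2, n3, n4, n6) E\<close>: \<open>ai\<close> is divisible by the \<open>ni\<close>-th power of the uniformizer.\<close>

fun divisible :: "('a::field \<Rightarrow> int) \<Rightarrow> nat \<times> nat \<times> nat \<times> nat \<times> nat \<Rightarrow> 'a weq \<Rightarrow> bool" where
  "divisible v (n1, n2, n3, n4, n6) (a1, a2, a3, a4, a6) \<longleftrightarrow>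
     a1 \<in> val_ideal v n1 \<and> a2 \<in> val_ideal v n2 \<and> a3 \<in> val_ideal v n3 \<and>
     a4 \<in> val_ideal v n4 \<and> a6 \<in> val_ideal v n6"

definition integral_weqs :: "('a::field \<Rightarrow> int) \<Rightarrow> 'a weq set" where
  "integral_weqs v = {E. divisible v (0, 0, 0, 0, 0) E}"

section \<open>Points and Tamagawa numbers\<close>

text \<open>\<open>None\<close> is the point at infinity.\<close>

type_synonym 'a point = "('a \<times> 'a) option"

fun on_curve :: "'a::field weq \<Rightarrow> 'a point \<Rightarrow> bool" where
  "on_curve E None \<longleftrightarrow> True"
| "on_curve (a1, a2, a3, a4, a6) (Some (x, y)) \<longleftrightarrow>
     y^2 + a1 * x * y + a3 * y = x^3 + a2 * x^2 + a4 * x + a6"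

text \<open>
  The chord and tangent law: the line through the two points (the tangent line if they coincide)
  is \<open>y = l x + m\<close>, unless it is vertical, in which case the sum is the point at infinity.
\<close>

fun point_add :: "'a::field weq \<Rightarrow> 'a point \<Rightarrow> 'a point \<Rightarrow> 'a point" where
  "point_add E None Q = Q"
| "point_add E (Some P) None = Some P"
| "point_add (a1, a2, a3, a4, a6) (Some (x1, y1)) (Some (x2, y2)) =
     (if x1 = x2 \<and> y1 + y2 + a1 * x2 + a3 = 0 then None
      else let
        l = (if x1 = x2
             then (3 * x1^2 + 2 * a2 * x1 + a4 - a1 * y1) / (2 * y1 + a1 * x1 + a3)
             else (y2 - y1) / (x2 - x1));
        m = y1 - l * x1;
        x3 = l^2 + a1 * l - a2 - x1 - x2
      in Some (x3, - (l + a1) * x3 - m - a3))"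

definition point_group :: "'a::field weq \<Rightarrow> 'a point monoid" where
  "point_group E = \<lparr>carrier = {P. on_curve E P}, mult = point_add E, one = None\<rparr>"

text \<open>
  The point reduces to a nonsingular point of the reduction of the integral equation. An affine
  point with a non-integral coordinate reduces to the point at infinity, which is nonsingular; the
  reduction of an integral affine point is nonsingular iff one of the two partial derivatives does
  not vanish there.
\<close>

fun nonsingular_reduction :: "('a::field \<Rightarrow> int) \<Rightarrow> 'a weq \<Rightarrow> 'a point \<Rightarrow> bool" where
  "nonsingular_reduction v E None \<longleftrightarrow> True"
| "nonsingular_reduction v (a1, a2, a3, a4, a6) (Some (x, y)) \<longleftrightarrow>
     x \<notin> val_ring v \<or> y \<notin> val_ring v \<or>
     a1 * y - (3 * x^2 + 2 * a2 * x + a4) \<notin> val_ideal v 1 \<or>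
     2 * y + a1 * x + a3 \<notin> val_ideal v 1"

definition E0_points :: "('a::field \<Rightarrow> int) \<Rightarrow> 'a weq \<Rightarrow> 'a point set" where
  "E0_points v E = {P. on_curve E P \<and> nonsingular_reduction v E P}"

definition isomorphic_weq :: "'a::field weq \<Rightarrow> 'a weq \<Rightarrow> bool" where
  "isomorphic_weq E M \<longleftrightarrow> (\<exists>u r s t. u \<noteq> 0 \<and> M = change_coords u r s t E)"

definition minimal_weq :: "('a::field \<Rightarrow> int) \<Rightarrow> 'a weq \<Rightarrow> 'a weq \<Rightarrow> bool" where
  "minimal_weq v E M \<longleftrightarrow>
     isomorphic_weq E M \<and> M \<in> integral_weqs v \<and>
     (\<forall>M'. isomorphic_weq E M' \<longrightarrow> M' \<in> integral_weqs v \<longrightarrow> v (weq_disc M) \<le> v (weq_disc M'))"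

text \<open>
  The index of \<open>E0\<close> in the group of rational points, where \<open>E0\<close> refers, as usual, to a minimal
  equation of the curve. Minimal equations are unique up to integral changes of coordinates with
  unit \<open>u\<close>, so that the choice is irrelevant.
\<close>

definition tamagawa_number :: "('a::field \<Rightarrow> int) \<Rightarrow> 'a weq \<Rightarrow> nat" where
  "tamagawa_number v E =
     (let M = (SOME M. minimal_weq v E M) in card (rcosets\<^bsub>point_group M\<^esub> (E0_points v M)))"

section \<open>Tate's algorithm\<close>

datatype kodaira =
  Type_I nat | Type_II | Type_III | Type_IV |
  Type_I_star nat | Type_IV_star | Type_III_star | Type_II_star

text \<open>
  For polynomials over the valuation ring: the reduction of \<open>a T^2 + b T + c\<close> (with \<open>a\<close> a unit),
  respectively of \<open>T^3 + b T^2 + c T + d\<close>, has distinct roots in an algebraic closure of the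
  residue field, that is, its discriminant does not vanish.
\<close>

definition distinct_roots2 :: "('a::field \<Rightarrow> int) \<Rightarrow> 'a \<Rightarrow> 'a \<Rightarrow> 'a \<Rightarrow> bool" where
  "distinct_roots2 v a b c \<longleftrightarrow> b^2 - 4 * a * c \<notin> val_ideal v 1"

definition distinct_roots3 :: "('a::field \<Rightarrow> int) \<Rightarrow> 'a \<Rightarrow> 'a \<Rightarrow> 'a \<Rightarrow> bool" where
  "distinct_roots3 v b c d \<longleftrightarrow>
     b^2 * c^2 - 4 * c^3 - 4 * b^3 * d - 27 * d^2 + 18 * b * c * d \<notin> val_ideal v 1"

text \<open>
  Whenever the algorithm says "make a change of variables such that", any integral change of
  variables with \<open>u = 1\<close> that achieves the required divisibilities may be taken.
\<close>

definition integral_change :: "('a::field \<Rightarrow> int) \<Rightarrow> 'a weq \<Rightarrow> 'a weq \<Rightarrow> bool" where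
  "integral_change v E F \<longleftrightarrow>
     (\<exists>r \<in> val_ring v. \<exists>s \<in> val_ring v. \<exists>t \<in> val_ring v. F = change_coords 1 r s t E)"

text \<open>
  \<open>tate_step v p E j F\<close>: in a single iteration of the algorithm started with \<open>E\<close>, step \<open>j\<close> is
  entered and the current equation, after the change of variables (if any) preceding the test of
  that step, is \<open>F\<close>. Here \<open>p\<close> is a uniformizer. Steps 7 and 8 are the cases where the cubic
  \<open>T^3 + a2/p T^2 + a4/p^2 T + a6/p^3\<close> of step 6 reduces to one with a double, respectively a
  triple root, which has been moved to \<open>T = 0\<close>. Entering step 11 means that the equation is not
  minimal.
\<close>

inductive tate_step ::
    "('a::field \<Rightarrow> int) \<Rightarrow> 'a \<Rightarrow> 'a weq \<Rightarrow> nat \<Rightarrow> 'a weq \<Rightarrow> bool" for v p E where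
  step1: "tate_step v p E 1 E"
| step2: "\<lbrakk>tate_step v p E 1 F; weq_disc F \<in> val_ideal v 1;
     integral_change v F F'; divisible v (0, 0, 1, 1, 1) F'\<rbrakk> \<Longrightarrow> tate_step v p E 2 F'"
| step3: "\<lbrakk>tate_step v p E 2 F; b2 F \<in> val_ideal v 1\<rbrakk> \<Longrightarrow> tate_step v p E 3 F"
| step4: "\<lbrakk>tate_step v p E 3 F; F = (a1, a2, a3, a4, a6); a6 \<in> val_ideal v 2\<rbrakk>
     \<Longrightarrow> tate_step v p E 4 F"
| step5: "\<lbrakk>tate_step v p E 4 F; b8 F \<in> val_ideal v 3\<rbrakk> \<Longrightarrow> tate_step v p E 5 F"
| step6: "\<lbrakk>tate_step v p E 5 F; b6 F \<in> val_ideal v 3;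
     integral_change v F F'; divisible v (1, 1, 2, 2, 3) F'\<rbrakk> \<Longrightarrow> tate_step v p E 6 F'"
| step7: "\<lbrakk>tate_step v p E 6 F; F = (a1, a2, a3, a4, a6);
     \<not> distinct_roots3 v (a2 / p) (a4 / p^2) (a6 / p^3);
     integral_change v F F'; divisible v (1, 1, 2, 3, 4) F';
     F' = (a1', a2', a3', a4', a6'); a2' \<notin> val_ideal v 2\<rbrakk> \<Longrightarrow> tate_step v p E 7 F'"
| step8: "\<lbrakk>tate_step v p E 6 F; F = (a1, a2, a3, a4, a6);
     \<not> distinct_roots3 v (a2 / p) (a4 / p^2) (a6 / p^3);
     integral_change v F F'; divisible v (1, 2, 2, 3, 4) F'\<rbrakk> \<Longrightarrow> tate_step v p E 8 F'"
| step9: "\<lbrakk>tate_step v p E 8 F; F = (a1, a2, a3, a4, a6);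
     \<not> distinct_roots2 v 1 (a3 / p^2) (- a6 / p^4);
     integral_change v F F'; divisible v (1, 2, 3, 3, 5) F'\<rbrakk> \<Longrightarrow> tate_step v p E 9 F'"
| step10: "\<lbrakk>tate_step v p E 9 F; F = (a1, a2, a3, a4, a6); a4 \<in> val_ideal v 4\<rbrakk>
     \<Longrightarrow> tate_step v p E 10 F"
| step11: "\<lbrakk>tate_step v p E 10 F; F = (a1, a2, a3, a4, a6); a6 \<in> val_ideal v 6\<rbrakk>
     \<Longrightarrow> tate_step v p E 11 F"

text \<open>
  The subprocedure of step 7, which alternates between the quadratics
  \<open>Y^2 + a3/p^(m+1) Y - a6/p^(2m+2)\<close> for \<open>n = 2 m - 1\<close> and
  \<open>a2/p X^2 + a4/p^(m+2) X + a6/p^(2m+3)\<close> for \<open>n = 2 m\<close>, starting with \<open>n = 1\<close>, until one of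
  them has distinct roots. As long as this is not the case the double root is moved to 0.
\<close>

definition istar_test :: "('a::field \<Rightarrow> int) \<Rightarrow> 'a \<Rightarrow> nat \<Rightarrow> 'a weq \<Rightarrow> bool" where
  "istar_test v p n F \<longleftrightarrow> (case F of (a1, a2, a3, a4, a6) \<Rightarrow>
     if odd n
     then let m = (n + 1) div 2 in distinct_roots2 v 1 (a3 / p^(m + 1)) (- a6 / p^(2 * m + 2))
     else let m = n div 2 in distinct_roots2 v (a2 / p) (a4 / p^(m + 2)) (a6 / p^(2 * m + 3)))"

text \<open>
  \<open>istar_step v p F n F'\<close>: started with the equation \<open>F\<close>, the subprocedure arrives at the \<open>n\<close>-th
  quadratic with current equation \<open>F'\<close>. The divisibilities required at that point are
  \<open>(1, 1, m + 1, m + 2, 2 m + 2)\<close> for \<open>n = 2 m - 1\<close> and \<open>(1, 1, m + 2, m + 2, 2 m + 3)\<close> for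
  \<open>n = 2 m\<close>.
\<close>

inductive istar_step ::
    "('a::field \<Rightarrow> int) \<Rightarrow> 'a \<Rightarrow> 'a weq \<Rightarrow> nat \<Rightarrow> 'a weq \<Rightarrow> bool" for v p F where
  start: "istar_step v p F 1 F"
| odd: "\<lbrakk>istar_step v p F (2 * m - 1) F'; 1 \<le> m; \<not> istar_test v p (2 * m - 1) F';
     integral_change v F' F''; divisible v (1, 1, m + 2, m + 2, 2 * m + 3) F''\<rbrakk>
     \<Longrightarrow> istar_step v p F (2 * m) F''"
| even: "\<lbrakk>istar_step v p F (2 * m) F'; 1 \<le> m; \<not> istar_test v p (2 * m) F';
     integral_change v F' F''; divisible v (1, 1, m + 2, m + 3, 2 * m + 4) F''\<rbrakk>
     \<Longrightarrow> istar_step v p F (2 * m + 1) F''"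

text \<open>An iteration started with \<open>E\<close> terminates in one of the steps 1 to 10 with the given type.\<close>

inductive tate_terminates ::
    "('a::field \<Rightarrow> int) \<Rightarrow> 'a \<Rightarrow> 'a weq \<Rightarrow> kodaira \<Rightarrow> bool" for v p E where
  term1: "\<lbrakk>tate_step v p E 1 F; weq_disc F \<notin> val_ideal v 1\<rbrakk>
     \<Longrightarrow> tate_terminates v p E (Type_I 0)"
| term2: "\<lbrakk>tate_step v p E 2 F; b2 F \<notin> val_ideal v 1\<rbrakk>
     \<Longrightarrow> tate_terminates v p E (Type_I (nat (v (weq_disc F))))"
| term3: "\<lbrakk>tate_step v p E 3 (a1, a2, a3, a4, a6); a6 \<notin> val_ideal v 2\<rbrakk>
     \<Longrightarrow> tate_terminates v p E Type_II"
| term4: "\<lbrakk>tate_step v p E 4 F; b8 F \<notin> val_ideal v 3\<rbrakk> \<Longrightarrow> tate_terminates v p E Type_III"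
| term5: "\<lbrakk>tate_step v p E 5 F; b6 F \<notin> val_ideal v 3\<rbrakk> \<Longrightarrow> tate_terminates v p E Type_IV"
| term6: "\<lbrakk>tate_step v p E 6 (a1, a2, a3, a4, a6);
     distinct_roots3 v (a2 / p) (a4 / p^2) (a6 / p^3)\<rbrakk>
     \<Longrightarrow> tate_terminates v p E (Type_I_star 0)"
| term7: "\<lbrakk>tate_step v p E 7 F; istar_step v p F n F'; istar_test v p n F'\<rbrakk>
     \<Longrightarrow> tate_terminates v p E (Type_I_star n)"
| term8: "\<lbrakk>tate_step v p E 8 (a1, a2, a3, a4, a6);
     distinct_roots2 v 1 (a3 / p^2) (- a6 / p^4)\<rbrakk> \<Longrightarrow> tate_terminates v p E Type_IV_star"
| term9: "\<lbrakk>tate_step v p E 9 (a1, a2, a3, a4, a6); a4 \<notin> val_ideal v 4\<rbrakk>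
     \<Longrightarrow> tate_terminates v p E Type_III_star"
| term10: "\<lbrakk>tate_step v p E 10 (a1, a2, a3, a4, a6); a6 \<notin> val_ideal v 6\<rbrakk>
     \<Longrightarrow> tate_terminates v p E Type_II_star"

text \<open>
  \<open>tate v p E k T\<close>: applied to \<open>E\<close>, Tate's algorithm completes \<open>k\<close> iterations (each ending with
  the replacement of \<open>ai\<close> by \<open>ai / p^i\<close>) and the next iteration terminates with Kodaira type \<open>T\<close>.
  The result does not depend on the changes of variables chosen on the way.
\<close>

inductive tate ::
    "('a::field \<Rightarrow> int) \<Rightarrow> 'a \<Rightarrow> 'a weq \<Rightarrow> nat \<Rightarrow> kodaira \<Rightarrow> bool" for v p where
  terminate: "tate_terminates v p E T \<Longrightarrow> tate v p E 0 T"
| restart: "\<lbrakk>tate_step v p E 11 (a1, a2, a3, a4, a6);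
     tate v p (a1 / p, a2 / p^2, a3 / p^3, a4 / p^4, a6 / p^6) k T\<rbrakk> \<Longrightarrow> tate v p E (Suc k) T"

section \<open>Local densities\<close>

definition local_density ::
    "('a::{field, topological_space} \<Rightarrow> int) \<Rightarrow> 'a \<Rightarrow> 'a weq measure \<Rightarrow> kodaira \<Rightarrow> nat \<Rightarrow> nat \<Rightarrow> real"
where
  "local_density v p M T n k =
     measure M {E \<in> integral_weqs v. weq_disc E \<noteq> 0 \<and> tate v p E k T \<and> tamagawa_number v E = n}"

end

theory Submission
  imports Defs
begin

text \<open>
  Writing \<open>D\<close> for \<open>(a\<^sub>i) \<mapsto> (\<pi>\<^sup>i a\<^sub>i)\<close> and \<open>\<tau>\<^sub>g\<close> for the integral change of coordinates with \<open>u = 1\<close> and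
  \<open>g = (r, s, t)\<close>, an equation reaches step 11 iff it is of the form \<open>\<tau>\<^sub>g (D F)\<close> with \<open>F\<close> integral, and
  \<open>\<tau>\<^sub>g (D F)\<close> is again in the image of \<open>D\<close> iff \<open>\<pi>\<^sup>2 | r\<close>, \<open>\<pi> | s\<close>, \<open>\<pi>\<^sup>3 | t\<close>. As type, Tamagawa number
  and iteration count are invariant under the \<open>\<tau>\<^sub>g\<close>, the equations with \<open>k + 1\<close> iterations are the disjoint
  union of \<open>Q\<^sup>1\<^sup>+\<^sup>2\<^sup>+\<^sup>3\<close> sets \<open>\<tau>\<^sub>g (D S)\<close>, where \<open>S\<close> is the set of those with \<open>k\<close> iterations. By uniqueness
  of Haar measure \<open>\<tau>\<^sub>g\<close> preserves the measure and \<open>D\<close> divides it by \<open>Q\<^sup>1\<^sup>+\<^sup>2\<^sup>+\<^sup>3\<^sup>+\<^sup>4\<^sup>+\<^sup>6\<close>. In total this is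
  a factor of \<open>Q\<^sup>-\<^sup>1\<^sup>0\<close>.
\<close>

section \<open>Changes of coordinates\<close>

text \<open>Substitute \<open>x' = u'^2 x'' + r'\<close> and
  \<open>y' = u'^3 y'' + s' u'^2 x'' + t'\<close> into the first change. The mixed term
  \<open>u^2 * s * r'\<close> arises from \<open>s u^2 x'\<close>; it makes the composition
  non-additive in \<open>t\<close>, which matters in the coset count at the end.\<close>

lemma change_coords_change_coords:
  fixes u u' :: "'a::field"
  assumes "u \<noteq> 0" "u' \<noteq> 0"
  shows "change_coords u' r' s' t' (change_coords u r s t E) =
    change_coords (u * u') (r + u^2 * r') (s + u * s') (t + u^3 * t' + u^2 * s * r') E"
proof -
  obtain a1 a2 a3 a4 a6 where E: "E = (a1, a2, a3, a4, a6)" by (metis prod_cases5)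
  show ?thesis unfolding E
    using assms by (simp add: divide_simps power_mult_distrib) (intro conjI; algebra)
qed

lemma change_coords_id [simp]: "change_coords 1 0 0 0 E = (E :: 'a::field weq)"
  by (cases E rule: prod_cases5) simp

lemma isomorphic_weq_trans: "isomorphic_weq E F \<Longrightarrow> isomorphic_weq F G \<Longrightarrow> isomorphic_weq E G"
  unfolding isomorphic_weq_def by (metis change_coords_change_coords no_zero_divisors)

lemma change_coords_inverse:
  fixes u :: "'a::field"
  assumes "u \<noteq> 0"
  shows "change_coords (1/u) (- r / u^2) (- s / u) ((s * r - t) / u^3) (change_coords u r s t E) = E"
  using assms by (subst change_coords_change_coords) (auto simp: field_simps)

lemma isomorphic_weq_sym: "isomorphic_weq E F \<Longrightarrow> isomorphic_weq F E"
  unfolding isomorphic_weq_def by (metis change_coords_inverse divide_eq_0_iff one_neq_zero)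

lemma isomorphic_weq_change_coords: "u \<noteq> 0 \<Longrightarrow> isomorphic_weq E (change_coords u r s t E)"
  unfolding isomorphic_weq_def by auto

text \<open>Isomorphic equations have literally the same predicate of minimal equations, so
  \<open>SOME\<close> selects the same \<open>M\<close> for both, and the uniqueness of minimal
  equations does not enter.\<close>

lemma tamagawa_number_isomorphic:
  assumes "isomorphic_weq E F"
  shows "tamagawa_number v E = tamagawa_number v F"
proof -
  have "isomorphic_weq E = isomorphic_weq F"
    using assms isomorphic_weq_trans isomorphic_weq_sym by blast
  hence "minimal_weq v E = minimal_weq v F"
    by (simp add: minimal_weq_def fun_eq_iff)
  thus ?thesis by (simp add: tamagawa_number_def)
qed

text \<open>The leading terms \<open>4 * r^3\<close> of the law for \<open>b6\<close> and
  \<open>3 * r^4\<close> of the law for \<open>b8\<close> will force \<open>r\<close> to be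
  integral.\<close>

lemma b_change_coords:
  "b2 (change_coords 1 r s t E) = b2 E + 12 * r"
  "b4 (change_coords 1 r s t E) = b4 E + r * b2 E + 6 * r^2"
  "b6 (change_coords 1 r s t E) = b6 E + 2 * r * b4 E + r^2 * b2 E + 4 * r^3"
  "b8 (change_coords 1 r s t E) = b8 E + 3 * r * b6 E + 3 * r^2 * b4 E + r^3 * b2 E + 3 * r^4"
  by (induct E rule: prod_induct5,
    simp only: b2.simps b4.simps b6.simps b8.simps change_coords.simps power_one div_by_1, algebra)+

lemma b8_relation: "4 * b8 E = b2 E * b6 E - b4 E ^ 2"
  by (induct E rule: prod_induct5, simp only: b2.simps b4.simps b6.simps b8.simps, algebra)

text \<open>As a polynomial in independent \<open>b\<close>s the discriminant is not invariant; its
  change vanishes modulo the relation between \<open>4 * b8\<close> and the other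
  \<open>b\<close>s.\<close>

lemma weq_disc_change_coords: "weq_disc (change_coords 1 r s t E) = weq_disc E"
  unfolding weq_disc_def b_change_coords using b8_relation[of E] by algebra

text \<open>The map \<open>D\<close> of the idea above; it undoes the division by powers of
  \<open>p\<close> at a restart.\<close>

fun scale_weq :: "'a::field \<Rightarrow> 'a weq \<Rightarrow> 'a weq" where
  "scale_weq p (a1, a2, a3, a4, a6) = (p * a1, p^2 * a2, p^3 * a3, p^4 * a4, p^6 * a6)"

lemma scale_weq_eq_change_coords: "p \<noteq> 0 \<Longrightarrow> scale_weq p E = change_coords (1 / p) 0 0 0 E"
  by (cases E rule: prod_cases5) (simp add: field_simps)

lemma isomorphic_scale_weq: "p \<noteq> 0 \<Longrightarrow> isomorphic_weq F (scale_weq p F)"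
  by (simp add: scale_weq_eq_change_coords isomorphic_weq_change_coords del: change_coords.simps)

text \<open>Under scaling, \<open>r\<close>, \<open>s\<close>, \<open>t\<close> carry the weights 2,
  1, 3. These weights are the source of the index \<open>Q^(2+1+3)\<close> in the final
  count.\<close>

lemma change_coords_scale_weq:
  "change_coords 1 (p^2 * r) (p * s) (p^3 * t) (scale_weq p E) = scale_weq p (change_coords 1 r s t E)"
  by (induct E rule: prod_induct5) (simp add: algebra_simps eval_nat_numeral)

lemma b_scale_weq:
  "b2 (scale_weq p E) = p^2 * b2 E" "b4 (scale_weq p E) = p^4 * b4 E"
  "b6 (scale_weq p E) = p^6 * b6 E" "b8 (scale_weq p E) = p^8 * b8 E"
  by (induct E rule: prod_induct5, simp add: algebra_simps eval_nat_numeral)+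

lemma weq_disc_scale_weq: "weq_disc (scale_weq p E) = p^12 * weq_disc E"
  by (simp add: weq_disc_def b_scale_weq algebra_simps power_mult_distrib flip: power_mult power_add)

lemma inj_scale_weq: "p \<noteq> 0 \<Longrightarrow> inj (scale_weq p)"
  by (rule injI) (auto elim!: scale_weq.elims)

lemma scale_weq_add: "scale_weq p (E + F) + scale_weq p 0 = scale_weq p E + scale_weq p F"
  by (induct E rule: prod_induct5, induct F rule: prod_induct5) (simp add: zero_prod_def algebra_simps)

lemma change_coords_scale_weq_inverse:
  "p \<noteq> 0 \<Longrightarrow> change_coords p 0 0 0 (scale_weq p E) = E"
  "p \<noteq> 0 \<Longrightarrow> scale_weq p (change_coords p 0 0 0 E) = E"
  by (induct E rule: prod_induct5, simp)+

section \<open>Valuations and Tate's algorithm\<close>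

locale valuation =
  fixes v :: "'a::field \<Rightarrow> int"
  assumes normalized: "normalized_valuation v"
begin

section \<open>Arithmetic of the ideals of the valuation ring\<close>

lemma v_mult: "x \<noteq> 0 \<Longrightarrow> y \<noteq> 0 \<Longrightarrow> v (x * y) = v x + v y"
  and v_add: "x \<noteq> 0 \<Longrightarrow> y \<noteq> 0 \<Longrightarrow> x + y \<noteq> 0 \<Longrightarrow> min (v x) (v y) \<le> v (x + y)"
  using normalized unfolding normalized_valuation_def by auto

lemma v_one: "v 1 = 0"
  using v_mult[of 1 1] by simp

lemma v_uminus: "v (- x) = v x"
proof (cases "x = 0")
  case False
  have "v (-1) + v (-1) = 0" using v_mult[of "-1" "-1"] v_one by simp
  hence "v (-1) = 0" by simp
  thus ?thesis using v_mult[of "-1" x] False by simp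
qed simp

lemma v_power: "x \<noteq> 0 \<Longrightarrow> v (x ^ n) = int n * v x"
  by (induction n) (auto simp: v_one v_mult algebra_simps)

lemma ideal_zero [simp]: "0 \<in> val_ideal v i"
  by (simp add: val_ideal_def)

lemma ideal_add: "x \<in> val_ideal v i \<Longrightarrow> y \<in> val_ideal v i \<Longrightarrow> x + y \<in> val_ideal v i"
  using v_add[of x y] by (cases "x = 0"; cases "y = 0"; cases "x + y = 0") (auto simp: val_ideal_def)

lemma ideal_uminus: "x \<in> val_ideal v i \<Longrightarrow> - x \<in> val_ideal v i"
  by (simp add: val_ideal_def v_uminus)

lemma ideal_diff: "x \<in> val_ideal v i \<Longrightarrow> y \<in> val_ideal v i \<Longrightarrow> x - y \<in> val_ideal v i"
  using ideal_add[of x i "- y"] ideal_uminus by simp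

lemma ideal_diff_commute: "x - y \<in> val_ideal v i \<longleftrightarrow> y - x \<in> val_ideal v i"
  using ideal_uminus[of "x - y" i] ideal_uminus[of "y - x" i] by auto

lemma ideal_mult: "x \<in> val_ideal v i \<Longrightarrow> y \<in> val_ideal v j \<Longrightarrow> x * y \<in> val_ideal v (i + j)"
  by (cases "x = 0"; cases "y = 0") (auto simp: val_ideal_def v_mult)

lemma ideal_mult_left: "x \<in> val_ring v \<Longrightarrow> y \<in> val_ideal v j \<Longrightarrow> x * y \<in> val_ideal v j"
  using ideal_mult[of x 0 y j] by simp

lemma ideal_mono: "x \<in> val_ideal v i \<Longrightarrow> j \<le> i \<Longrightarrow> x \<in> val_ideal v j"
  by (auto simp: val_ideal_def)

lemma ideal_ring: "x \<in> val_ideal v i \<Longrightarrow> x \<in> val_ring v"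
  using ideal_mono by blast

lemma ring_one: "1 \<in> val_ring v"
  by (simp add: val_ideal_def v_one)

lemma one_notin_ideal: "1 \<notin> val_ideal v 1"
  by (simp add: val_ideal_def v_one)

lemma ring_of_nat: "of_nat n \<in> val_ring v"
  by (induction n) (auto intro: ideal_add ring_one)

lemma ring_numeral: "numeral n \<in> val_ring v"
  using ring_of_nat[of "numeral n"] by simp

lemma ideal_power: "x \<in> val_ideal v i \<Longrightarrow> n > 0 \<Longrightarrow> x ^ n \<in> val_ideal v i"
proof (induction n)
  case (Suc n)
  thus ?case by (cases "n = 0") (auto intro: ideal_mult_left ideal_ring)
qed simp

lemmas ideal_intros = ideal_add ideal_uminus ideal_diff ideal_mult_left
  ideal_power ring_one ring_numeral

lemma inverse_ideal: "x \<notin> val_ring v \<Longrightarrow> 1 / x \<in> val_ideal v 1"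
proof -
  assume x: "x \<notin> val_ring v"
  hence "x \<noteq> 0" by auto
  hence "v x + v (1 / x) = 0" using v_mult[of x "1 / x"] v_one by simp
  thus ?thesis using x by (auto simp: val_ideal_def)
qed

text \<open>The degree 2 case of a valuation ring being integrally closed: if \<open>x\<close> were
  not integral, dividing the equation by \<open>x^2\<close> would place 1 in the maximal
  ideal.\<close>

lemma quadratic_integral:
  assumes "x^2 + b * x + c = 0" "b \<in> val_ring v" "c \<in> val_ring v"
  shows "x \<in> val_ring v"
proof (rule ccontr)
  assume x: "x \<notin> val_ring v"
  define y where "y = 1 / x"
  have y: "y \<in> val_ideal v 1" unfolding y_def by (rule inverse_ideal[OF x])
  have "x \<noteq> 0" using x by auto
  have "x * y = 1" using \<open>x \<noteq> 0\<close> by (simp add: y_def)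
  hence "1 = - b * y - c * y^2" using assms(1) by algebra
  moreover have "- b * y - c * y^2 \<in> val_ideal v 1" using assms y by (intro ideal_intros) auto
  ultimately show False using one_notin_ideal by metis
qed

section \<open>Integral equations and integral changes of coordinates\<close>

lemma integral_weqs_iff:
  "(a1, a2, a3, a4, a6) \<in> integral_weqs v \<longleftrightarrow> a1 \<in> val_ring v \<and> a2 \<in> val_ring v \<and>
    a3 \<in> val_ring v \<and> a4 \<in> val_ring v \<and> a6 \<in> val_ring v"
  by (simp add: integral_weqs_def)

lemma b_integral:
  assumes "E \<in> integral_weqs v"
  shows "b2 E \<in> val_ring v" "b4 E \<in> val_ring v" "b6 E \<in> val_ring v" "b8 E \<in> val_ring v"
  using assms by (cases E rule: prod_cases5, auto simp: integral_weqs_iff intro!: ideal_intros)+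

lemma change_coords_integral:
  assumes "E \<in> integral_weqs v" "r \<in> val_ring v" "s \<in> val_ring v" "t \<in> val_ring v"
  shows "change_coords 1 r s t E \<in> integral_weqs v"
  using assms by (cases E rule: prod_cases5) (auto simp: integral_weqs_iff intro!: ideal_intros)

text \<open>First \<open>r\<close> is integral, by the laws for \<open>b6\<close> and
  \<open>b8\<close>. Then the laws for \<open>a2\<close> and \<open>a6\<close>, read as monic
  quadratic equations for \<open>s\<close> and \<open>t\<close> with integral coefficients, give the
  rest.\<close>

lemma change_coords_integral_imp:
  assumes E: "E \<in> integral_weqs v" and F: "change_coords 1 r s t E \<in> integral_weqs v"
  shows "r \<in> val_ring v" "s \<in> val_ring v" "t \<in> val_ring v"
proof -
  show r: "r \<in> val_ring v"
  proof (rule ccontr)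
    assume r: "r \<notin> val_ring v"
    define y where "y = 1 / r"
    have y: "y \<in> val_ideal v 1" unfolding y_def by (rule inverse_ideal[OF r])
    have ry: "r * y = 1" using r by (auto simp: y_def)
    txt \<open>The transformation laws of \<open>b6\<close> and \<open>b8\<close> put \<open>4\<close> and \<open>3\<close> into the maximal ideal.\<close>
    let ?F = "change_coords 1 r s t E"
    note b = b_integral[OF E] b_integral[OF F]
    let ?four = "(b6 ?F - b6 E) * y^3 - 2 * b4 E * y^2 - b2 E * y"
    let ?three = "(b8 ?F - b8 E) * y^4 - 3 * b6 E * y^3 - 3 * b4 E * y^2 - b2 E * y"
    have "4 = ?four" "3 = ?three" unfolding b_change_coords using ry by algebra+
    moreover have "?four \<in> val_ideal v 1" "?three \<in> val_ideal v 1" 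
      using b y by (intro ideal_intros; simp)+
    \<comment> \<open>Since 4 and 3 are coprime, all residue characteristics are covered at
      once.\<close>
    ultimately have "4 - 3 \<in> val_ideal v 1" using ideal_diff by metis
    thus False using one_notin_ideal by simp
  qed
  obtain a1 a2 a3 a4 a6 where EE: "E = (a1, a2, a3, a4, a6)" by (metis prod_cases5)
  obtain c1 c2 c3 c4 c6 where FF: "change_coords 1 r s t E = (c1, c2, c3, c4, c6)"
    by (metis prod_cases5)
  have a: "a1 \<in> val_ring v" "a2 \<in> val_ring v" "a3 \<in> val_ring v" "a4 \<in> val_ring v" "a6 \<in> val_ring v"
    "c1 \<in> val_ring v" "c2 \<in> val_ring v" "c3 \<in> val_ring v" "c4 \<in> val_ring v" "c6 \<in> val_ring v"
    using E F unfolding FF unfolding EE integral_weqs_iff by auto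
  have c2: "c2 = a2 - s * a1 + 3 * r - s^2"
    and c6: "c6 = a6 + r * a4 + r^2 * a2 + r^3 - t * a3 - t^2 - r * t * a1"
    using FF unfolding EE by auto
  show "s \<in> val_ring v"
  proof (rule quadratic_integral)
    show "s^2 + a1 * s + (c2 - a2 - 3 * r) = 0" unfolding c2 by algebra
    show "c2 - a2 - 3 * r \<in> val_ring v" using a r by (intro ideal_intros)
  qed fact
  show "t \<in> val_ring v"
  proof (rule quadratic_integral)
    show "t^2 + (a3 + r * a1) * t + (c6 - a6 - r * a4 - r^2 * a2 - r^3) = 0"
      unfolding c6 by algebra
    show "a3 + r * a1 \<in> val_ring v" "c6 - a6 - r * a4 - r^2 * a2 - r^3 \<in> val_ring v"
      using a r by (intro ideal_intros; simp)+
  qed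
qed

lemma integral_change_refl: "integral_change v E E"
  unfolding integral_change_def by (metis change_coords_id ideal_zero)

lemma integral_change_sym:
  assumes "integral_change v E F" shows "integral_change v F E"
proof -
  obtain r s t where R: "r \<in> val_ring v" "s \<in> val_ring v" "t \<in> val_ring v"
    and F: "F = change_coords 1 r s t E"
    using assms unfolding integral_change_def by auto
  have "E = change_coords 1 (- r) (- s) (s * r - t) F"
    using change_coords_inverse[of 1 r s t E] by (simp add: F)
  moreover have "- r \<in> val_ring v" "- s \<in> val_ring v" "s * r - t \<in> val_ring v"
    using R by (auto intro!: ideal_intros)
  ultimately show ?thesis unfolding integral_change_def by blast
qed

lemma integral_change_trans:
  assumes "integral_change v E F" "integral_change v F G" shows "integral_change v E G"
proof -
  obtain r s t where R: "r \<in> val_ring v" "s \<in> val_ring v" "t \<in> val_ring v"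
    and F: "F = change_coords 1 r s t E"
    using assms unfolding integral_change_def by auto
  obtain r' s' t' where R': "r' \<in> val_ring v" "s' \<in> val_ring v" "t' \<in> val_ring v"
    and G: "G = change_coords 1 r' s' t' F"
    using assms unfolding integral_change_def by auto
  have "G = change_coords 1 (r + r') (s + s') (t + t' + s * r') E"
    by (simp add: F G change_coords_change_coords del: change_coords.simps)
  moreover have "r + r' \<in> val_ring v" "s + s' \<in> val_ring v" "t + t' + s * r' \<in> val_ring v"
    using R R' by (auto intro!: ideal_intros)
  ultimately show ?thesis unfolding integral_change_def by blast
qed

lemma integral_change_weq_disc: "integral_change v E F \<Longrightarrow> weq_disc F = weq_disc E"
  unfolding integral_change_def by (auto simp: weq_disc_change_coords simp del: change_coords.simps)

lemma integral_change_isomorphic: "integral_change v E F \<Longrightarrow> isomorphic_weq E F"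
  unfolding integral_change_def isomorphic_weq_def by (metis one_neq_zero)

lemma integral_change_integral:
  "integral_change v E F \<Longrightarrow> E \<in> integral_weqs v \<Longrightarrow> F \<in> integral_weqs v"
  unfolding integral_change_def using change_coords_integral by blast

section \<open>Invariance of Tate's algorithm under integral changes\<close>

lemma tate_step_integral_change: "tate_step v p E j F \<Longrightarrow> integral_change v E F"
  by (induction rule: tate_step.induct)
    (assumption | rule integral_change_refl | erule (1) integral_change_trans)+

lemma tate_step_1: "tate_step v p E 1 F \<longleftrightarrow> F = E"
proof
  assume "tate_step v p E 1 F"
  thus "F = E" by cases auto
qed (simp only: tate_step.step1)

text \<open>The free change of variables before step 2 absorbs the change from \<open>E'\<close> to
  \<open>E\<close>, and all later steps depend only on the current equation. Step 1 is excluded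
  because there the current equation is the starting one.\<close>

lemma tate_step_transfer:
  assumes "tate_step v p E j F" "j \<ge> 2" "integral_change v E' E"
  shows "tate_step v p E' j F"
  using assms(1,2)
proof (induction rule: tate_step.induct)
  case step1
  thus ?case by simp
next
  case (step2 F F')
  hence "F = E" using tate_step_1 by blast
  show ?case
  proof (rule tate_step.step2[OF tate_step.step1])
    show "weq_disc E' \<in> val_ideal v 1"
      using step2 \<open>F = E\<close> integral_change_weq_disc[OF assms(3)] by metis
    show "integral_change v E' F'"
      using step2 \<open>F = E\<close> integral_change_trans[OF assms(3)] by blast
  qed fact
next
  case (step3 F)
  show ?case by (rule tate_step.step3[OF step3.IH step3.hyps(2-)]) simp
next
  case (step4 F a1 a2 a3 a4 a6)
  show ?case by (rule tate_step.step4[OF step4.IH step4.hyps(2-)]) simp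
next
  case (step5 F)
  show ?case by (rule tate_step.step5[OF step5.IH step5.hyps(2-)]) simp
next
  case (step6 F F')
  show ?case by (rule tate_step.step6[OF step6.IH step6.hyps(2-)]) simp
next
  case (step7 F a1 a2 a3 a4 a6 F' c1 c2 c3 c4 c6)
  show ?case by (rule tate_step.step7[OF step7.IH step7.hyps(2-)]) simp
next
  case (step8 F a1 a2 a3 a4 a6 F')
  show ?case by (rule tate_step.step8[OF step8.IH step8.hyps(2-)]) simp
next
  case (step9 F a1 a2 a3 a4 a6 F')
  show ?case by (rule tate_step.step9[OF step9.IH step9.hyps(2-)]) simp
next
  case (step10 F a1 a2 a3 a4 a6)
  show ?case by (rule tate_step.step10[OF step10.IH step10.hyps(2-)]) simp
next
  case (step11 F a1 a2 a3 a4 a6)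
  show ?case by (rule tate_step.step11[OF step11.IH step11.hyps(2-)]) simp
qed

text \<open>Termination in step 1 depends only on the discriminant, which is invariant; every other
  termination passes through a step covered by \<open>tate_step_transfer\<close>.\<close>

lemma tate_terminates_transfer:
  assumes "tate_terminates v p E T" "integral_change v E' E"
  shows "tate_terminates v p E' T"
proof -
  have step: "tate_step v p E' j F" if "tate_step v p E j F" "j \<ge> 2" for j F
    using tate_step_transfer that assms(2) by blast
  show ?thesis using assms(1)
  proof cases
    case (term1 F)
    hence "weq_disc E' \<notin> val_ideal v 1"
      using tate_step_1 integral_change_weq_disc[OF assms(2)] by metis
    thus ?thesis unfolding term1 by (rule tate_terminates.term1[OF tate_step.step1])
  next
    case (term2 F)
    show ?thesis unfolding term2 by (rule tate_terminates.term2[OF step]) (use term2 in auto)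
  next
    case (term3 a1 a2 a3 a4 a6)
    show ?thesis unfolding term3 by (rule tate_terminates.term3[OF step]) (use term3 in auto)
  next
    case (term4 F)
    show ?thesis unfolding term4 by (rule tate_terminates.term4[OF step]) (use term4 in auto)
  next
    case (term5 F)
    show ?thesis unfolding term5 by (rule tate_terminates.term5[OF step]) (use term5 in auto)
  next
    case (term6 a1 a2 a3 a4 a6)
    show ?thesis unfolding term6 by (rule tate_terminates.term6[OF step]) (use term6 in auto)
  next
    case (term7 F n F')
    show ?thesis unfolding term7 by (rule tate_terminates.term7[OF step]) (use term7 in auto)
  next
    case (term8 a1 a2 a3 a4 a6)
    show ?thesis unfolding term8 by (rule tate_terminates.term8[OF step]) (use term8 in auto)
  next
    case (term9 a1 a2 a3 a4 a6)
    show ?thesis unfolding term9 by (rule tate_terminates.term9[OF step]) (use term9 in auto)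
  next
    case (term10 a1 a2 a3 a4 a6)
    show ?thesis unfolding term10 by (rule tate_terminates.term10[OF step]) (use term10 in auto)
  qed
qed

text \<open>A case distinction suffices: after a transferred step 11 both runs restart from the same
  equation.\<close>

lemma tate_transfer:
  assumes "tate v p E k T" "integral_change v E' E"
  shows "tate v p E' k T"
  using assms
proof (cases rule: tate.cases)
  case terminate
  thus ?thesis using assms tate_terminates_transfer tate.terminate by blast
next
  case (restart a1 a2 a3 a4 a6 k)
  have "tate_step v p E' 11 (a1, a2, a3, a4, a6)"
    by (rule tate_step_transfer[OF restart(2) _ assms(2)]) simp
  thus ?thesis using restart tate.restart by blast
qed

end

text \<open>A transversal of the \<open>i\<close>-th ideal in the valuation ring. Including the
  cardinality lets indices be read off as powers of \<open>Q = residue_card v\<close>.\<close>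

definition residue_system :: "('a::field \<Rightarrow> int) \<Rightarrow> nat \<Rightarrow> 'a set \<Rightarrow> bool" where
  "residue_system v i A \<longleftrightarrow> finite A \<and> A \<subseteq> val_ring v \<and> card A = residue_card v ^ i \<and>
     (\<forall>x\<in>val_ring v. \<exists>!a. a \<in> A \<and> x - a \<in> val_ideal v i)"

lemma residue_systemD:
  assumes "residue_system v i A"
  shows "finite A" "A \<subseteq> val_ring v" "card A = residue_card v ^ i"
    and "x \<in> val_ring v \<Longrightarrow> \<exists>a\<in>A. x - a \<in> val_ideal v i"
    and "x \<in> val_ring v \<Longrightarrow> a \<in> A \<Longrightarrow> b \<in> A \<Longrightarrow> x - a \<in> val_ideal v i \<Longrightarrow>
      x - b \<in> val_ideal v i \<Longrightarrow> a = b"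
  using assms unfolding residue_system_def by blast+

locale uniformized_valuation = valuation v for v :: "'a::field \<Rightarrow> int" +
  fixes p :: 'a
  assumes p_nonzero: "p \<noteq> 0" and v_p: "v p = 1"
begin

section \<open>Restarts and the image of scaling\<close>

lemma v_p_power: "v (p ^ i) = int i"
  using v_power[OF p_nonzero] v_p by simp

lemma p_power_mult_ideal_iff: "p ^ i * x \<in> val_ideal v (i + j) \<longleftrightarrow> x \<in> val_ideal v j"
  using p_nonzero by (cases "x = 0") (auto simp: val_ideal_def v_mult v_p_power)

lemma p_power_mult_ring: "x \<in> val_ring v \<Longrightarrow> j \<le> i \<Longrightarrow> p ^ i * x \<in> val_ideal v j"
  using p_power_mult_ideal_iff[of i x 0] ideal_mono by auto

lemma p_mult_ring: "x \<in> val_ring v \<Longrightarrow> p * x \<in> val_ideal v 1"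
  using p_power_mult_ring[of x 1 1] by simp

lemma ideal_imp_p_power_mult: "x \<in> val_ideal v i \<Longrightarrow> \<exists>y\<in>val_ring v. x = p ^ i * y"
  using p_power_mult_ideal_iff[of i "x / p ^ i" 0] p_nonzero
  by (intro bexI[of _ "x / p ^ i"]) auto

lemma p_in_ring: "p \<in> val_ring v"
  using v_p by (simp add: val_ideal_def)

lemma scale_weq_integral: "E \<in> integral_weqs v \<Longrightarrow> scale_weq p E \<in> integral_weqs v"
  by (induct E rule: prod_induct5) (auto simp: integral_weqs_iff p_power_mult_ring
      intro: ideal_mult_left p_in_ring)

lemma divisible_scale_weq:
  assumes "E \<in> integral_weqs v" "n1 \<le> 1" "n2 \<le> 2" "n3 \<le> 3" "n4 \<le> 4" "n6 \<le> 6"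
  shows "divisible v (n1, n2, n3, n4, n6) (scale_weq p E)"
  using assms by (induct E rule: prod_induct5)
    (auto simp: integral_weqs_iff p_power_mult_ring intro: ideal_mono[OF p_mult_ring])

lemma divisible_imp_scale_weq:
  assumes "divisible v (1, 2, 3, 4, 6) E"
  shows "\<exists>F\<in>integral_weqs v. E = scale_weq p F"
proof -
  obtain a1 a2 a3 a4 a6 where E: "E = (a1, a2, a3, a4, a6)" by (metis prod_cases5)
  obtain c1 c2 c3 c4 c6 where "c1 \<in> val_ring v" "c2 \<in> val_ring v" "c3 \<in> val_ring v"
    "c4 \<in> val_ring v" "c6 \<in> val_ring v"
    "a1 = p ^ 1 * c1" "a2 = p ^ 2 * c2" "a3 = p ^ 3 * c3" "a4 = p ^ 4 * c4" "a6 = p ^ 6 * c6"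
    using assms ideal_imp_p_power_mult unfolding E divisible.simps by meson
  thus ?thesis unfolding E
    by (intro bexI[of _ "(c1, c2, c3, c4, c6)"]) (auto simp: integral_weqs_iff)
qed

text \<open>Step 9 leaves the exponents \<open>(1, 2, 3, 3, 5)\<close>; the tests entering steps 10
  and 11 keep the equation and raise the last two to 4 and 6.\<close>

lemma tate_step_11_divisible:
  assumes "tate_step v p E 11 F"
  shows "divisible v (1, 2, 3, 4, 6) F"
  using assms
proof cases
  case (step11 a1 a2 a3 a4 a6)
  from step11(1) show ?thesis
  proof cases
    case (step10 c1 c2 c3 c4 c6)
    from step10(1) have "divisible v (1, 2, 3, 3, 5) F" by cases simp_all
    thus ?thesis using step10 step11 by simp
  qed simp_all
qed simp_all

text \<open>The one change needed is made before step 2; afterwards the identity is always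
  admissible. Each test passes because the tested quantity is divisible by a sufficient power of
  \<open>p\<close>: \<open>p^12\<close> for the discriminant, \<open>p^2\<close>,
  \<open>p^6\<close>, \<open>p^8\<close> for \<open>b2\<close>, \<open>b6\<close>,
  \<open>b8\<close>, and \<open>p^6\<close> and \<open>p^2\<close> for the discriminants of the
  cubic and the quadratic.\<close>

lemma tate_step_11_scale_weq:
  assumes F: "F \<in> integral_weqs v" and EF: "integral_change v E (scale_weq p F)"
  shows "tate_step v p E 11 (scale_weq p F)"
proof -
  let ?G = "scale_weq p F"
  obtain a1 a2 a3 a4 a6 where FF: "F = (a1, a2, a3, a4, a6)" by (metis prod_cases5)
  have R: "a1 \<in> val_ring v" "a2 \<in> val_ring v" "a3 \<in> val_ring v" "a4 \<in> val_ring v" "a6 \<in> val_ring v"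
    using F unfolding FF integral_weqs_iff by auto
  have G: "?G = (p * a1, p^2 * a2, p^3 * a3, p^4 * a4, p^6 * a6)" by (simp add: FF)
  note b = b_integral[OF F]
  have "weq_disc F \<in> val_ring v" unfolding weq_disc_def using b by (intro ideal_intros) simp_all
  hence "weq_disc E \<in> val_ideal v 1"
    using integral_change_weq_disc[OF EF] p_power_mult_ring[of "weq_disc F" 1 12]
    by (simp add: weq_disc_scale_weq)
  hence "tate_step v p E 2 ?G"
    by (rule tate_step.step2[OF tate_step.step1 _ EF divisible_scale_weq[OF F]]) simp_all
  hence "tate_step v p E 3 ?G"
    by (rule tate_step.step3) (simp add: b_scale_weq b p_power_mult_ring)
  hence "tate_step v p E 4 ?G"
    by (rule tate_step.step4[OF _ G]) (simp add: R p_power_mult_ring)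
  hence "tate_step v p E 5 ?G"
    by (rule tate_step.step5) (simp add: b_scale_weq b p_power_mult_ring)
  hence 6: "tate_step v p E 6 ?G"
    by (rule tate_step.step6[OF _ _ integral_change_refl divisible_scale_weq[OF F]])
      (simp_all add: b_scale_weq b p_power_mult_ring)
  \<comment> \<open>The cubic of step 6 reduces to \<open>T^3\<close> and the quadratic of step 8 to
    \<open>Y^2\<close>, so the multiple roots already lie at 0.\<close>
  have cubic: "p^2 * a2 / p = p * a2" "p^4 * a4 / p^2 = p^2 * a4" "p^6 * a6 / p^3 = p^3 * a6"
    and quadratic: "p^3 * a3 / p^2 = p * a3" "- (p^6 * a6) / p^4 = - (p^2 * a6)"
    using p_nonzero by (auto simp: field_simps eval_nat_numeral)
  have cubic_ring: "a2^2 * a4^2 - 4 * a4^3 - 4 * a2^3 * a6 - 27 * a6^2 + 18 * a2 * a4 * a6 \<in> val_ring v"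
    using R by (intro ideal_intros) simp_all
  have "(p * a2)^2 * (p^2 * a4)^2 - 4 * (p^2 * a4)^3 - 4 * (p * a2)^3 * (p^3 * a6) -
    27 * (p^3 * a6)^2 + 18 * (p * a2) * (p^2 * a4) * (p^3 * a6) =
    p^6 * (a2^2 * a4^2 - 4 * a4^3 - 4 * a2^3 * a6 - 27 * a6^2 + 18 * a2 * a4 * a6)"
    by algebra
  hence "\<not> distinct_roots3 v (p^2 * a2 / p) (p^4 * a4 / p^2) (p^6 * a6 / p^3)"
    unfolding cubic distinct_roots3_def
    using p_power_mult_ring[OF cubic_ring, of 1 6] by simp
  with 6 have 8: "tate_step v p E 8 ?G"
    by (rule tate_step.step8[OF _ G _ integral_change_refl divisible_scale_weq[OF F]]) simp_all
  have quadratic_ring: "a3^2 + 4 * a6 \<in> val_ring v"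
    using R by (intro ideal_intros) simp_all
  have "(p * a3)^2 - 4 * 1 * - (p^2 * a6) = p^2 * (a3^2 + 4 * a6)" by algebra
  hence "\<not> distinct_roots2 v 1 (p^3 * a3 / p^2) (- (p^6 * a6) / p^4)"
    unfolding quadratic distinct_roots2_def
    using p_power_mult_ring[OF quadratic_ring, of 1 2] by simp
  with 8 have "tate_step v p E 9 ?G"
    by (rule tate_step.step9[OF _ G _ integral_change_refl divisible_scale_weq[OF F]]) simp_all
  hence "tate_step v p E 10 ?G"
    by (rule tate_step.step10[OF _ G]) (simp add: R p_power_mult_ring)
  thus ?thesis
    by (rule tate_step.step11[OF _ G]) (simp add: R p_power_mult_ring)
qed

text \<open>Replaces a full iteration of the algorithm by the existence of an integral change into
  the image of scaling; from here on the individual steps are no longer inspected.\<close>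

lemma tate_Suc_iff:
  "tate v p E (Suc k) T \<longleftrightarrow>
    (\<exists>F\<in>integral_weqs v. integral_change v E (scale_weq p F) \<and> tate v p F k T)"
proof
  assume "tate v p E (Suc k) T"
  thus "\<exists>F\<in>integral_weqs v. integral_change v E (scale_weq p F) \<and> tate v p F k T"
  proof cases
    case (restart a1 a2 a3 a4 a6)
    obtain F where F: "F \<in> integral_weqs v" "(a1, a2, a3, a4, a6) = scale_weq p F"
      using divisible_imp_scale_weq[OF tate_step_11_divisible[OF restart(1)]] by blast
    have "F = (a1 / p, a2 / p^2, a3 / p^3, a4 / p^4, a6 / p^6)"
      using F(2) p_nonzero by (cases F rule: prod_cases5) simp
    thus ?thesis using restart F tate_step_integral_change by metis
  qed
next
  assume "\<exists>F\<in>integral_weqs v. integral_change v E (scale_weq p F) \<and> tate v p F k T"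
  then obtain F where F: "F \<in> integral_weqs v" "integral_change v E (scale_weq p F)"
    and "tate v p F k T" by blast
  obtain a1 a2 a3 a4 a6 where G: "scale_weq p F = (a1, a2, a3, a4, a6)" by (metis prod_cases5)
  have FF: "F = (a1 / p, a2 / p^2, a3 / p^3, a4 / p^4, a6 / p^6)"
    using G p_nonzero by (cases F rule: prod_cases5) auto
  show "tate v p E (Suc k) T"
    using tate_step_11_scale_weq[OF F, unfolded G] \<open>tate v p F k T\<close>[unfolded FF]
    by (rule tate.restart)
qed

text \<open>Dividing \<open>r\<close>, \<open>s\<close>, \<open>t\<close> by \<open>p^2\<close>,
  \<open>p\<close>, \<open>p^3\<close> cancels the scaling and leaves a change between the integral
  equations \<open>E\<close> and \<open>F\<close>, to which
  \<open>change_coords_integral_imp\<close> applies. This yields the disjointness of the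
  pieces.\<close>

lemma integral_change_scale_weq_imp:
  assumes E: "E \<in> integral_weqs v" and F: "F \<in> integral_weqs v"
    and EF: "scale_weq p F = change_coords 1 r s t (scale_weq p E)"
  shows "r \<in> val_ideal v 2" "s \<in> val_ideal v 1" "t \<in> val_ideal v 3" "integral_change v E F"
proof -
  define r' s' t' where "r' = r / p^2" and "s' = s / p" and "t' = t / p^3"
  have *: "r = p^2 * r'" "s = p * s'" "t = p^3 * t'"
    using p_nonzero by (auto simp: r'_def s'_def t'_def)
  have FF: "F = change_coords 1 r' s' t' E"
    using EF injD[OF inj_scale_weq[OF p_nonzero]] unfolding * change_coords_scale_weq by metis
  note R = change_coords_integral_imp[OF E F[unfolded FF]]
  show "r \<in> val_ideal v 2" "s \<in> val_ideal v 1" "t \<in> val_ideal v 3"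
    unfolding * using R p_power_mult_ring p_mult_ring by auto
  show "integral_change v E F"
    unfolding integral_change_def using R FF by blast
qed

text \<open>The converse: such parameters move through the scaling as integral ones. This lets the
  pieces be indexed by residue classes of \<open>(r, s, t)\<close>.\<close>

lemma integral_change_scale_weq:
  assumes "r \<in> val_ideal v 2" "s \<in> val_ideal v 1" "t \<in> val_ideal v 3"
  shows "\<exists>F. integral_change v E F \<and> change_coords 1 r s t (scale_weq p E) = scale_weq p F"
proof -
  obtain r' s' t' where R: "r' \<in> val_ring v" "s' \<in> val_ring v" "t' \<in> val_ring v"
    and "r = p ^ 2 * r'" "s = p ^ 1 * s'" "t = p ^ 3 * t'"
    using assms ideal_imp_p_power_mult by meson
  hence "change_coords 1 r s t (scale_weq p E) = scale_weq p (change_coords 1 r' s' t' E)"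
    by (simp only: power_one_right change_coords_scale_weq)
  thus ?thesis unfolding integral_change_def using R by blast
qed

section \<open>Transversals of the powers of the maximal ideal\<close>

lemma residue_system_1:
  assumes "residue_card v > 0"
  shows "\<exists>A. residue_system v 1 A"
proof -
  let ?r = "{(x, y). x \<in> val_ring v \<and> y \<in> val_ring v \<and> x - y \<in> val_ideal v 1}"
  have eq: "equiv (val_ring v) ?r"
  proof (rule equivI)
    show "refl_on (val_ring v) ?r" by (auto simp: refl_on_def)
    show "sym ?r" using ideal_diff_commute by (auto simp: sym_def)
    show "trans ?r"
    proof (rule transI, clarsimp)
      fix x y z assume "x - y \<in> val_ideal v (Suc 0)" "y - z \<in> val_ideal v (Suc 0)"
      from ideal_add[OF this] show "x - z \<in> val_ideal v (Suc 0)" by simp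
    qed
  qed auto
  define c where "c = (\<lambda>X :: 'a set. SOME x. x \<in> X)"
  let ?Q = "val_ring v // ?r"
  have c: "c X \<in> X" if "X \<in> ?Q" for X
    using in_quotient_imp_non_empty[OF eq that] unfolding c_def by (simp add: some_in_eq)
  have sub: "X \<subseteq> val_ring v" if "X \<in> ?Q" for X
    using in_quotient_imp_subset[OF eq that] .
  have inj: "inj_on c ?Q"
  proof (rule inj_onI)
    fix X Y assume XY: "X \<in> ?Q" "Y \<in> ?Q" "c X = c Y"
    have "c X \<in> X \<inter> Y" using c[OF XY(1)] c[OF XY(2)] XY(3) by simp
    thus "X = Y" using quotient_disj[OF eq XY(1,2)] by auto
  qed
  \<comment> \<open>An infinite set has \<open>card\<close> 0, so a positive
    \<open>residue_card\<close> encodes finiteness of the residue field.\<close>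
  have fin: "finite ?Q" using assms unfolding residue_card_def by (simp add: card_gt_0_iff)
  have "\<exists>!a. a \<in> c ` ?Q \<and> x - a \<in> val_ideal v 1" if x: "x \<in> val_ring v" for x
  proof (rule ex_ex1I)
    have "?r `` {x} \<in> ?Q" using x by (rule quotientI)
    from c[OF this] have "x - c (?r `` {x}) \<in> val_ideal v 1"
      by (simp only: Image_singleton_iff mem_Collect_eq prod.case)
    with \<open>?r `` {x} \<in> ?Q\<close> show "\<exists>a. a \<in> c ` ?Q \<and> x - a \<in> val_ideal v 1"
      by (intro exI[of _ "c (?r `` {x})"] conjI imageI)
  next
    fix a b
    assume "a \<in> c ` ?Q \<and> x - a \<in> val_ideal v 1" "b \<in> c ` ?Q \<and> x - b \<in> val_ideal v 1"
    then obtain X Y where X: "X \<in> ?Q" "a = c X" and Y: "Y \<in> ?Q" "b = c Y"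
      and ab: "x - a \<in> val_ideal v 1" "x - b \<in> val_ideal v 1" by auto
    have "a - b \<in> val_ideal v 1" using ideal_diff[OF ab(2,1)] by simp
    moreover have "a \<in> X" "b \<in> Y" using c X Y by simp_all
    moreover have "a \<in> val_ring v" "b \<in> val_ring v"
      using \<open>a \<in> X\<close> \<open>b \<in> Y\<close> sub[OF X(1)] sub[OF Y(1)] by auto
    ultimately have "(a, b) \<in> ?r" by simp
    hence "X = Y" by (rule quotient_eqI[OF eq X(1) Y(1) \<open>a \<in> X\<close> \<open>b \<in> Y\<close>])
    thus "a = b" using X Y by simp
  qed
  moreover have "card (c ` ?Q) = residue_card v"
    using card_image[OF inj] unfolding residue_card_def by simp
  moreover have "c ` ?Q \<subseteq> val_ring v" using c sub by (auto dest: subsetD)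
  ultimately have "residue_system v 1 (c ` ?Q)" unfolding residue_system_def using fin by simp
  thus ?thesis by blast
qed

text \<open>Expansion in digits: representatives modulo the next power are
  \<open>a + p^i * b\<close>, with \<open>a\<close> a representative modulo \<open>p^i\<close> and
  \<open>b\<close> a representative of a residue class.\<close>

lemma residue_system_exists:
  assumes "residue_card v > 0"
  shows "\<exists>A. residue_system v i A"
proof (induction i)
  case 0
  have "residue_system v 0 {0}" by (auto simp: residue_system_def)
  thus ?case by blast
next
  case (Suc i)
  obtain A where A: "residue_system v i A" using Suc by blast
  obtain B where B: "residue_system v 1 B" using residue_system_1[OF assms] by blast
  let ?f = "\<lambda>(a, b). a + p ^ i * b"
  \<comment> \<open>Adding \<open>p^i * b\<close> back gives a congruence modulo \<open>p^i\<close>,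
    which determines \<open>a\<close>; cancelling \<open>p^i\<close> in the difference then
    determines \<open>b\<close>.\<close>
  have unique: "a = a' \<and> b = b'"
    if "a \<in> A" "a' \<in> A" "b \<in> B" "b' \<in> B" "x \<in> val_ring v"
      "x - (a + p ^ i * b) \<in> val_ideal v (Suc i)" "x - (a' + p ^ i * b') \<in> val_ideal v (Suc i)"
    for a a' b b' x
  proof -
    have ring: "b \<in> val_ring v" "b' \<in> val_ring v" using residue_systemD(2)[OF B] that by auto
    have "(x - (a + p ^ i * b)) + p ^ i * b \<in> val_ideal v i"
      "(x - (a' + p ^ i * b')) + p ^ i * b' \<in> val_ideal v i"
      using ideal_mono[OF that(6), of i] ideal_mono[OF that(7), of i]
        p_power_mult_ring[OF ring(1), of i i] p_power_mult_ring[OF ring(2), of i i]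
      by (simp_all only: ideal_add order_refl le_SucI)
    hence "x - a \<in> val_ideal v i" "x - a' \<in> val_ideal v i" by simp_all
    hence [simp]: "a' = a" using residue_systemD(5)[OF A that(5,2,1)] by simp
    have "(x - (a' + p ^ i * b')) - (x - (a + p ^ i * b)) = p ^ i * (b - b')"
      by (simp add: algebra_simps)
    hence "p ^ i * (b - b') \<in> val_ideal v (i + 1)" using ideal_diff[OF that(7,6)] by simp
    hence "b - b' \<in> val_ideal v 1" using p_power_mult_ideal_iff by blast
    moreover have "b - b \<in> val_ideal v 1" by simp
    ultimately have "b = b'" using residue_systemD(5)[OF B ring(1) that(3,4)] by simp
    thus ?thesis by simp
  qed
  have ring: "?f ab \<in> val_ring v" if "ab \<in> A \<times> B" for ab
  proof -
    have "fst ab \<in> val_ring v" "snd ab \<in> val_ring v"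
      using that residue_systemD(2)[OF A] residue_systemD(2)[OF B] by auto
    hence "fst ab + p ^ i * snd ab \<in> val_ring v"
      by (intro ideal_add p_power_mult_ring) simp_all
    thus ?thesis by (simp add: case_prod_beta)
  qed
  have "inj_on ?f (A \<times> B)"
  proof (rule inj_onI)
    fix ab cd assume *: "ab \<in> A \<times> B" "cd \<in> A \<times> B" "?f ab = ?f cd"
    show "ab = cd"
      using unique[of "fst ab" "fst cd" "snd ab" "snd cd" "?f ab"] * ring[OF *(1)]
      by (simp add: case_prod_beta prod_eq_iff mem_Times_iff)
  qed
  hence "card (?f ` (A \<times> B)) = residue_card v ^ Suc i"
    using A B by (simp add: card_image card_cartesian_product residue_system_def)
  moreover have "\<exists>!c. c \<in> ?f ` (A \<times> B) \<and> x - c \<in> val_ideal v (Suc i)" if x: "x \<in> val_ring v" for x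
  proof (rule ex_ex1I)
    obtain a where a: "a \<in> A" "x - a \<in> val_ideal v i"
      using residue_systemD(4)[OF A x] by blast
    then obtain y where y: "y \<in> val_ring v" "x - a = p ^ i * y"
      using ideal_imp_p_power_mult by blast
    obtain b where b: "b \<in> B" "y - b \<in> val_ideal v 1"
      using residue_systemD(4)[OF B y(1)] by blast
    have "x - (a + p ^ i * b) = p ^ i * (y - b)" using y by (simp add: algebra_simps)
    hence "x - (a + p ^ i * b) \<in> val_ideal v (Suc i)"
      using b p_power_mult_ideal_iff[of i "y - b" 1] by simp
    moreover have "a + p ^ i * b \<in> ?f ` (A \<times> B)" using a b by (intro image_eqI[of _ _ "(a, b)"]) auto
    ultimately show "\<exists>c. c \<in> ?f ` (A \<times> B) \<and> x - c \<in> val_ideal v (Suc i)" by blast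
  next
    fix c d
    assume c: "c \<in> ?f ` (A \<times> B) \<and> x - c \<in> val_ideal v (Suc i)"
      and d: "d \<in> ?f ` (A \<times> B) \<and> x - d \<in> val_ideal v (Suc i)"
    obtain a b where ab: "a \<in> A" "b \<in> B" "c = a + p ^ i * b" using c by auto
    obtain a' b' where ab': "a' \<in> A" "b' \<in> B" "d = a' + p ^ i * b'" using d by auto
    show "c = d" using unique[OF ab(1) ab'(1) ab(2) ab'(2) x] c d ab(3) ab'(3) by simp
  qed
  moreover have "finite (?f ` (A \<times> B))" using A B by (auto simp: residue_system_def)
  moreover have "?f ` (A \<times> B) \<subseteq> val_ring v" using ring by blast
  ultimately have "residue_system v (Suc i) (?f ` (A \<times> B))"
    unfolding residue_system_def by (intro conjI ballI)
  thus ?case by blast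
qed

end

section \<open>Uniqueness of Haar measure\<close>

text \<open>A descending filtration by open subgroups, of finite index in \<open>V 0\<close>,
  forming a neighbourhood base at 0. The classes do not link topology and addition;
  \<open>open_coset\<close> and \<open>ex_coset_subset\<close> provide the link.\<close>

locale ball_group =
  fixes V :: "nat \<Rightarrow> 'g::{topological_space, ab_group_add} set"
  assumes zero_in: "0 \<in> V m"
    and diff_in: "x \<in> V m \<Longrightarrow> y \<in> V m \<Longrightarrow> x - y \<in> V m"
    and Suc_subset: "V (Suc m) \<subseteq> V m"
    and open_coset: "open ((+) x ` V m)"
    and ex_coset_subset: "open U \<Longrightarrow> x \<in> U \<Longrightarrow> \<exists>m. (+) x ` V m \<subseteq> U"
    and ex_reps: "\<exists>A. finite A \<and> A \<subseteq> V 0 \<and> (\<forall>x\<in>V 0. \<exists>!a. a \<in> A \<and> x - a \<in> V m)"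
begin

section \<open>Topology and Borel sets of the filtered group\<close>

lemma coset_iff: "y \<in> (+) x ` A \<longleftrightarrow> y - x \<in> (A :: 'g set)"
  by (auto intro: image_eqI[of _ _ "y - x"])

lemma V_mono: "m \<le> n \<Longrightarrow> V n \<subseteq> V m"
  by (rule lift_Suc_antimono_le[of V, OF Suc_subset])

lemma uminus_in: "x \<in> V m \<Longrightarrow> - x \<in> V m"
  using diff_in[OF zero_in] by simp

lemma add_in: "x \<in> V m \<Longrightarrow> y \<in> V m \<Longrightarrow> x + y \<in> V m"
  using diff_in[OF _ uminus_in] by fastforce

lemma open_V: "open (V m)"
  using open_coset[of 0 m] by simp

lemma openI_coset:
  assumes "\<And>x. x \<in> U \<Longrightarrow> \<exists>m. (+) x ` V m \<subseteq> U"
  shows "open U"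
proof (subst open_subopen, intro ballI)
  fix x assume "x \<in> U"
  then obtain m where "(+) x ` V m \<subseteq> U" using assms by blast
  moreover have "x \<in> (+) x ` V m" using zero_in by (simp add: coset_iff)
  ultimately show "\<exists>T. open T \<and> x \<in> T \<and> T \<subseteq> U" using open_coset by blast
qed

lemma continuous_onI_coset:
  assumes "\<And>m. \<exists>n. \<forall>x y. x - y \<in> V n \<longrightarrow> f x - f y \<in> V m"
  shows "continuous_on UNIV (f :: 'g \<Rightarrow> 'g)"
  unfolding continuous_on_open_vimage[OF open_UNIV]
proof (intro allI impI, simp, rule openI_coset)
  fix U x assume U: "open U" "x \<in> f -` U"
  then obtain m where m: "(+) (f x) ` V m \<subseteq> U" using ex_coset_subset[of U "f x"] by auto
  obtain n where "\<forall>x y. x - y \<in> V n \<longrightarrow> f x - f y \<in> V m" using assms by blast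
  hence "(+) x ` V n \<subseteq> f -` U" using m by (auto simp: coset_iff subset_iff)
  thus "\<exists>n. (+) x ` V n \<subseteq> f -` U" by blast
qed

text \<open>A translate is the preimage under the opposite translation, which is continuous by the
  coset criterion.\<close>

lemma translate_borel: 
  assumes "A \<in> sets borel"
  shows "(+) x ` A \<in> sets (borel :: 'g measure)"
proof -
  have "continuous_on UNIV (\<lambda>y. y - x)" by (rule continuous_onI_coset) auto
  hence "(\<lambda>y. y - x) \<in> borel_measurable borel" by (rule borel_measurable_continuous_onI)
  hence "(\<lambda>y. y - x) -` A \<inter> space borel \<in> sets borel" using assms by (rule measurable_sets)
  also have "(\<lambda>y. y - x) -` A \<inter> space borel = (+) x ` A" by (auto simp: coset_iff)
  finally show ?thesis .
qed

text \<open>The ultrametric phenomenon: for a common point \<open>z\<close>,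
  \<open>y - x = (z - x) - (z - y)\<close> lies in the larger subgroup.\<close>

lemma cosets_comparable:
  assumes "m \<le> n"
  shows "(+) x ` V m \<inter> (+) y ` V n = {} \<or> (+) y ` V n \<subseteq> (+) x ` V m"
proof (cases "(+) x ` V m \<inter> (+) y ` V n = {}")
  case False
  then obtain z where "z \<in> (+) x ` V m" "z \<in> (+) y ` V n" by blast
  hence "z - x \<in> V m" "z - y \<in> V n" by (simp_all only: coset_iff)
  hence "y - x \<in> V m" using diff_in[of "z - x" m "z - y"] V_mono[OF assms] by auto
  hence "(+) y ` V n \<subseteq> (+) x ` V m"
    using add_in[of "_ - y" m "y - x"] V_mono[OF assms] by (fastforce simp: coset_iff)
  thus ?thesis by blast
qed simp

text \<open>The generator for the uniqueness of measures on \<open>V 0\<close>; the empty set is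
  added to make it closed under intersection.\<close>

definition ball_family :: "'g set set" where
  "ball_family = insert {} {(+) x ` V m | x m. x \<in> V 0}"

lemma ball_familyE:
  assumes "B \<in> ball_family" "B \<noteq> {}"
  obtains x m where "x \<in> V 0" "B = (+) x ` V m"
proof -
  have "\<exists>x m. B = (+) x ` V m \<and> x \<in> V 0"
    using assms by (simp only: ball_family_def insert_iff mem_Collect_eq simp_thms)
  thus ?thesis using that by (elim exE conjE)
qed

lemma ball_family_cosets: "x \<in> V 0 \<Longrightarrow> (+) x ` V m \<in> ball_family"
  by (auto simp: ball_family_def)

lemma coset_subset_V0: "x \<in> V 0 \<Longrightarrow> (+) x ` V m \<subseteq> V 0"
  using add_in V_mono[of 0 m] by auto

lemma ball_family_Pow: "ball_family \<subseteq> Pow (V 0)"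
  using coset_subset_V0 by (auto simp: ball_family_def)

lemma Int_stable_ball_family: "Int_stable ball_family"
proof (rule Int_stableI)
  fix B C assume B: "B \<in> ball_family" and C: "C \<in> ball_family"
  show "B \<inter> C \<in> ball_family"
  proof (cases "B = {} \<or> C = {}")
    case True
    thus ?thesis by (auto simp: ball_family_def)
  next
    case False
    hence "B \<noteq> {}" "C \<noteq> {}" by simp_all
    obtain x m where "x \<in> V 0" and B': "B = (+) x ` V m" by (rule ball_familyE[OF B \<open>B \<noteq> {}\<close>])
    obtain y n where "y \<in> V 0" and C': "C = (+) y ` V n" by (rule ball_familyE[OF C \<open>C \<noteq> {}\<close>])
    hence "B \<inter> C = {} \<or> B \<inter> C = B \<or> B \<inter> C = C"
      using cosets_comparable[of m n x y] cosets_comparable[of n m y x] by (cases "m \<le> n")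
        (simp_all add: B' C' Int_absorb1 Int_absorb2 Int_commute disj_commute; blast)+
    thus ?thesis using B C by (auto simp: ball_family_def)
  qed
qed

text \<open>Each level \<open>m\<close> has finitely many cosets inside \<open>V 0\<close>, so the
  cosets contained in \<open>U\<close> form a countable family. They cover \<open>U\<close> because
  any point of a coset may serve as its centre.\<close>

lemma open_in_sigma_ball_family:
  assumes "open U" "U \<subseteq> V 0"
  shows "U \<in> sigma_sets (V 0) ball_family"
proof -
  define A where "A = (\<lambda>m. SOME A. finite A \<and> A \<subseteq> V 0 \<and> (\<forall>x\<in>V 0. \<exists>!a. a \<in> A \<and> x - a \<in> V m))"
  have *: "finite (A m) \<and> A m \<subseteq> V 0 \<and> (\<forall>x\<in>V 0. \<exists>!a. a \<in> A m \<and> x - a \<in> V m)" for m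
    unfolding A_def by (rule someI_ex[OF ex_reps[of m]])
  have A: "finite (A m)" "A m \<subseteq> V 0" "\<And>x. x \<in> V 0 \<Longrightarrow> \<exists>!a. a \<in> A m \<and> x - a \<in> V m" for m
    by (simp_all only: *)
  let ?F = "\<lambda>m. {(+) a ` V m | a. a \<in> A m \<and> (+) a ` V m \<subseteq> U}"
  have "U = (\<Union>m. \<Union>(?F m))"
  proof
    show "U \<subseteq> (\<Union>m. \<Union>(?F m))"
    proof
      fix x assume x: "x \<in> U"
      obtain m where m: "(+) x ` V m \<subseteq> U" using ex_coset_subset[OF assms(1) x] by blast
      obtain a where a: "a \<in> A m" "x - a \<in> V m" using A(3)[of x m] x assms(2) by blast
      have "(+) a ` V m \<subseteq> (+) x ` V m"
      proof
        fix z assume "z \<in> (+) a ` V m"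
        hence "z - a \<in> V m" by (simp add: coset_iff)
        hence "(z - a) - (x - a) \<in> V m" using a(2) by (rule diff_in)
        thus "z \<in> (+) x ` V m" by (simp add: coset_iff)
      qed
      hence "(+) a ` V m \<in> ?F m" using m a(1) by blast
      moreover have "x \<in> (+) a ` V m" using a(2) by (simp add: coset_iff)
      ultimately show "x \<in> (\<Union>m. \<Union>(?F m))" by blast
    qed
  qed blast
  also have "\<dots> \<in> sigma_sets (V 0) ball_family"
  proof (intro sigma_sets_UNION)
    show "countable (range (\<lambda>m. \<Union>(?F m)))" by simp
  next
    fix B assume "B \<in> range (\<lambda>m. \<Union>(?F m))"
    then obtain m where B: "B = \<Union>(?F m)" by blast
    have "finite (?F m)" using A(1)[of m] by simp
    hence "countable (?F m)" by (rule countable_finite)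
    thus "B \<in> sigma_sets (V 0) ball_family" unfolding B
    proof (rule sigma_sets_UNION)
      fix C assume "C \<in> ?F m"
      then obtain a where "C = (+) a ` V m" "a \<in> V 0" using A(2) by blast
      thus "C \<in> sigma_sets (V 0) ball_family" using ball_family_cosets by (auto intro: sigma_sets.Basic)
    qed
  qed
  finally show ?thesis .
qed

lemma sets_restrict_V0: "sets (restrict_space borel (V 0)) = sigma_sets (V 0) ball_family"
proof
  have *: "(\<inter>) (V 0) ` sigma_sets UNIV {U. open U} = sigma_sets (V 0) ((\<inter>) (V 0) ` {U. open U})"
    by (rule sigma_sets_Int) (auto intro: sigma_sets.Basic open_V)
  show "sets (restrict_space borel (V 0)) \<subseteq> sigma_sets (V 0) ball_family"
    unfolding sets_restrict_space sets_borel *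
    by (rule sigma_sets_mono) (auto intro: open_in_sigma_ball_family open_V)
next
  have "ball_family \<subseteq> sets (restrict_space borel (V 0))"
  proof
    fix B assume B: "B \<in> ball_family"
    hence "B \<in> sets borel" using open_coset by (auto simp: ball_family_def)
    thus "B \<in> sets (restrict_space borel (V 0))"
      using B ball_family_Pow open_V by (subst sets_restrict_space_iff) auto
  qed
  from sets.sigma_sets_subset[OF this]
  show "sigma_sets (V 0) ball_family \<subseteq> sets (restrict_space borel (V 0))"
    by (simp add: space_restrict_space)
qed

text \<open>\<open>W\<close> is the disjoint union of the translates of \<open>H\<close> by
  \<open>A\<close>. A general Borel set \<open>H\<close> is allowed so that images of balls under
  affine maps are covered too.\<close>

lemma emeasure_cosets:
  assumes "sets M = sets borel"
    and trans: "\<And>x A. A \<in> sets borel \<Longrightarrow> emeasure M ((+) x ` A) = emeasure M A"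
    and "finite A" and H: "H \<in> sets borel"
    and sub: "\<And>a h. a \<in> A \<Longrightarrow> h \<in> H \<Longrightarrow> a + h \<in> W"
    and unique: "\<And>x. x \<in> W \<Longrightarrow> \<exists>!a. a \<in> A \<and> x - a \<in> H"
  shows "emeasure M W = of_nat (card A) * emeasure M (H :: 'g set)"
proof -
  have "W = (\<Union>a\<in>A. (+) a ` H)"
  proof
    show "W \<subseteq> (\<Union>a\<in>A. (+) a ` H)" using unique by (fastforce simp: coset_iff)
  qed (use sub in auto)
  moreover have "disjoint_family_on (\<lambda>a. (+) a ` H) A"
    unfolding disjoint_family_on_def
  proof (intro ballI impI)
    fix a b assume "a \<in> A" "b \<in> A" "a \<noteq> b"
    show "(+) a ` H \<inter> (+) b ` H = {}"
    proof (rule ccontr)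
      assume "(+) a ` H \<inter> (+) b ` H \<noteq> {}"
      then obtain z where z: "z \<in> (+) a ` H" "z \<in> (+) b ` H" by blast
      hence "z \<in> W" using sub \<open>a \<in> A\<close> by blast
      with unique z \<open>a \<in> A\<close> \<open>b \<in> A\<close> \<open>a \<noteq> b\<close> show False unfolding coset_iff by blast
    qed
  qed
  moreover have "(\<lambda>a. (+) a ` H) ` A \<subseteq> sets M" using assms(1) translate_borel[OF H] by blast
  ultimately have "emeasure M W = (\<Sum>a\<in>A. emeasure M ((+) a ` H))"
    using sum_emeasure \<open>finite A\<close> by metis
  thus ?thesis using trans H by simp
qed

text \<open>Uniqueness of Haar measure, in the form used below: sending \<open>X\<close> to
  \<open>card C\<close> times the measure of its image under \<open>f\<close> gives a measure that
  agrees with \<open>M\<close> on all balls in \<open>V 0\<close>, hence on all Borel subsets of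
  \<open>V 0\<close>. The affinity condition covers maps with \<open>f 0\<close> nonzero.\<close>

lemma emeasure_affine_image:
  fixes f g :: "'g \<Rightarrow> 'g"
  assumes sets_M: "sets M = sets borel"
    and trans: "\<And>x A. A \<in> sets borel \<Longrightarrow> emeasure M ((+) x ` A) = emeasure M A"
    and M0: "emeasure M (V 0) = 1"
    and affine: "\<And>x y. f (x + y) + f 0 = f x + f y"
    and gf: "\<And>x. g (f x) = x" and fg: "\<And>x. f (g x) = x"
    and cont: "continuous_on UNIV g"
    and C: "finite C" "\<And>c x. c \<in> C \<Longrightarrow> x \<in> V 0 \<Longrightarrow> c + f x \<in> V 0"
      "\<And>x. x \<in> V 0 \<Longrightarrow> \<exists>!c. c \<in> C \<and> x - c \<in> f ` V 0"
    and S: "S \<in> sets borel" "S \<subseteq> V 0"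
  shows "f ` S \<in> sets borel" "emeasure M S = of_nat (card C) * emeasure M (f ` S)"
proof -
  have image: "f ` X = g -` X" for X
    using gf fg by (auto intro!: image_eqI)
  have g: "g \<in> measurable M borel"
    using borel_measurable_continuous_onI[OF cont] measurable_cong_sets[OF sets_M refl] by blast
  have spaceM: "space M = UNIV" using sets_eq_imp_space_eq[OF sets_M] by simp
  have fborel: "f ` X \<in> sets borel" if "X \<in> sets borel" for X
    using measurable_sets[OF g that] unfolding image sets_M spaceM by simp
  show "f ` S \<in> sets borel" by (rule fborel[OF S(1)])
  \<comment> \<open>Pushing forward along \<open>g\<close>, the inverse of \<open>f\<close>,
    measures images under \<open>f\<close>.\<close>
  define N where "N = scale_measure (of_nat (card C)) (distr M borel g)"
  have N: "emeasure N X = of_nat (card C) * emeasure M (f ` X)" if "X \<in> sets borel" for X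
    unfolding N_def using that by (simp add: emeasure_distr[OF g] image spaceM)
  have sets_N: "sets N = sets borel" by (simp add: N_def)
  have fdiff: "f x - f y = f (x - y) - f 0" for x y
    using affine[of "x - y" y] by (simp add: algebra_simps)
  have Vb: "V m \<in> sets borel" for m using open_V by simp
  \<comment> \<open>\<open>V 0\<close> is partitioned by the translates of its image by
    \<open>C\<close>, so \<open>N\<close> also gives \<open>V 0\<close> the mass 1.\<close>
  have N0: "of_nat (card C) * emeasure M (f ` V 0) = 1"
    using emeasure_cosets[OF sets_M trans C(1) fborel[OF Vb[of 0]], of "V 0"] C(2,3) M0 by auto
  have eq: "emeasure M X = emeasure N X" if XB: "X \<in> ball_family" for X
  proof (cases "X = {}")
    case False
    obtain x m where X: "x \<in> V 0" "X = (+) x ` V m" by (rule ball_familyE[OF XB False])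
    obtain A where A: "finite A" "A \<subseteq> V 0" "\<forall>x\<in>V 0. \<exists>!a. a \<in> A \<and> x - a \<in> V m"
      using ex_reps[of m] by (elim exE conjE)
    note A3 = bspec[OF A(3)]
    have "emeasure M (V 0) = of_nat (card A) * emeasure M (V m)"
      using A(2) V_mono[of 0 m]
      by (intro emeasure_cosets[OF sets_M trans A(1) Vb] A3) (auto intro: add_in)
    hence M1: "of_nat (card A) * emeasure M (V m) = 1" using M0 by simp
    \<comment> \<open>The linear part of \<open>f\<close>: translating by \<open>a\<close> before
      applying \<open>f\<close> is translating by \<open>h a\<close> afterwards. Thus
      \<open>h\<close> carries the coset decomposition of \<open>V 0\<close> to one of its
      image.\<close>
    define h where "h a = f a - f 0" for a
    have "inj_on h A"
      using gf unfolding h_def by (intro inj_onI) (metis diff_add_cancel)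
    have h: "h a + f y = f (a + y)" "f y - h a = f (y - a)" for a y
      using affine[of a y] fdiff[of y a] by (auto simp: h_def algebra_simps)
    have inj_f: "f a = f b \<longleftrightarrow> a = b" for a b using gf by metis
    have f_mem: "f a \<in> f ` Y \<longleftrightarrow> a \<in> Y" for a Y using inj_f by auto
    have "emeasure M (f ` V 0) = of_nat (card (h ` A)) * emeasure M (f ` V m)"
    proof (rule emeasure_cosets[OF sets_M trans _ fborel[OF Vb]])
      show "finite (h ` A)" using A(1) by simp
    next
      fix a z assume "a \<in> h ` A" "z \<in> f ` V m"
      then obtain b y where "b \<in> A" "y \<in> V m" "a = h b" "z = f y" by blast
      moreover have "b + y \<in> V 0" using calculation A(2) V_mono[of 0 m] by (blast intro: add_in)
      ultimately show "a + z \<in> f ` V 0" by (simp add: h)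
    next
      fix z assume "z \<in> f ` V 0"
      then obtain y where y: "y \<in> V 0" "z = f y" by blast
      obtain a where a: "a \<in> A" "y - a \<in> V m" using A3[OF y(1)] by blast
      show "\<exists>!c. c \<in> h ` A \<and> z - c \<in> f ` V m"
      proof (rule ex1I[of _ "h a"])
        show "h a \<in> h ` A \<and> z - h a \<in> f ` V m" using a by (simp add: y h)
      next
        fix c assume c: "c \<in> h ` A \<and> z - c \<in> f ` V m"
        then obtain b where b: "b \<in> A" "c = h b" by blast
        have "y - b \<in> V m" using c by (simp add: y h b f_mem)
        thus "c = h a" using A3[OF y(1)] a b by blast
      qed
    qed
    hence "emeasure M (f ` V 0) = of_nat (card A) * emeasure M (f ` V m)"
      using card_image[OF \<open>inj_on h A\<close>] by simp
    hence N1: "of_nat (card A) * (of_nat (card C) * emeasure M (f ` V m)) = 1"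
      using N0 by (simp add: mult.left_commute)
    have "f ` X = (+) (h x) ` f ` V m" unfolding X(2) by (simp add: image_image h)
    hence "emeasure M (f ` X) = emeasure M (f ` V m)" using trans[OF fborel[OF Vb]] by simp
    hence "emeasure N X = of_nat (card C) * emeasure M (f ` V m)"
      using N[of X] translate_borel[OF Vb] X(2) by simp
    moreover have "emeasure M X = emeasure M (V m)" unfolding X(2) by (rule trans[OF Vb])
    \<comment> \<open>Both measures of \<open>X\<close>, multiplied by \<open>card A\<close>, equal
      1; cancelling in the extended reals requires a nonzero finite factor.\<close>
    moreover have "card A \<noteq> 0" using M1 by (intro notI) simp
    ultimately show ?thesis
      using M1 N1 ennreal_mult_cancel_left[of "of_nat (card A)" "emeasure M X" "emeasure N X"]
      by (auto simp: ennreal_of_nat_eq_real_of_nat)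
  qed simp
  have rs: "emeasure (restrict_space L (V 0)) X = emeasure L X"
    if "sets L = sets borel" "X \<subseteq> V 0" for L X
    using that Vb[of 0] sets_eq_imp_space_eq[OF that(1)] by (intro emeasure_restrict_space) auto
  have "restrict_space M (V 0) = restrict_space N (V 0)"
  proof (intro measure_eqI_generator_eq[OF Int_stable_ball_family ball_family_Pow])
    fix X assume "X \<in> ball_family"
    thus "emeasure (restrict_space M (V 0)) X = emeasure (restrict_space N (V 0)) X"
      using eq rs[OF sets_M] rs[OF sets_N] ball_family_Pow by auto
  next
    show "sets (restrict_space M (V 0)) = sigma_sets (V 0) ball_family"
      "sets (restrict_space N (V 0)) = sigma_sets (V 0) ball_family"
      using sets_restrict_V0 sets_M sets_N by (simp_all add: sets_restrict_space)
  next
    show "range (\<lambda>_ :: nat. V 0) \<subseteq> ball_family"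
      using ball_family_cosets[OF zero_in, of 0] by auto
  next
    show "emeasure (restrict_space M (V 0)) (V 0) \<noteq> \<infinity>" by (simp add: rs[OF sets_M] M0)
  qed auto
  hence "emeasure M S = emeasure N S" using rs[OF sets_M S(2)] rs[OF sets_N S(2)] by simp
  thus "emeasure M S = of_nat (card C) * emeasure M (f ` S)" using N[OF S(1)] by simp
qed

end

section \<open>Weierstrass equations over a local field\<close>

text \<open>A decreasing sequence of open neighbourhoods forming a local base at each point,
  packaged so that it can be iterated through the nested pairs of \<open>'a weq\<close>.\<close>

definition ball_base :: "('x::topological_space \<Rightarrow> nat \<Rightarrow> 'x set) \<Rightarrow> bool" where
  "ball_base N \<longleftrightarrow> (\<forall>x m. open (N x m) \<and> x \<in> N x m \<and> N x (Suc m) \<subseteq> N x m) \<and>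
     (\<forall>U x. open U \<longrightarrow> x \<in> U \<longrightarrow> (\<exists>m. N x m \<subseteq> U))"

text \<open>One index has to serve both factors; since the neighbourhoods decrease, the maximum of
  the two indices does.\<close>

lemma ball_base_Times:
  assumes N: "ball_base N" and N': "ball_base N'"
  shows "ball_base (\<lambda>(x, y) m. N x m \<times> N' y m)"
proof -
  have anti: "m \<le> n \<Longrightarrow> N x n \<subseteq> N x m" "m \<le> n \<Longrightarrow> N' y n \<subseteq> N' y m" for x y m n
    using N N' lift_Suc_antimono_le[of "N x" m n] lift_Suc_antimono_le[of "N' y" m n]
    by (auto simp: ball_base_def)
  have "\<exists>m. N x m \<times> N' y m \<subseteq> U" if U: "open U" "(x, y) \<in> U" for x y U
  proof -
    obtain A B where AB: "open A" "open B" "x \<in> A" "y \<in> B" "A \<times> B \<subseteq> U"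
      using open_prod_elim[OF U] by (metis mem_Times_iff fst_conv snd_conv)
    obtain m where m: "N x m \<subseteq> A" using N AB unfolding ball_base_def by blast
    obtain n where n: "N' y n \<subseteq> B" using N' AB unfolding ball_base_def by blast
    have "N x (max m n) \<times> N' y (max m n) \<subseteq> U"
      using anti(1)[of m "max m n" x] anti(2)[of n "max m n" y] m n AB(5) by fastforce
    thus ?thesis by blast
  qed
  moreover have "N x (Suc m) \<times> N' y (Suc m) \<subseteq> N x m \<times> N' y m" for x y m
    by (intro Sigma_mono anti) simp_all
  ultimately show ?thesis
    using N N' unfolding ball_base_def by (simp add: open_Times split_paired_all)
qed

section \<open>Balls and cosets of Weierstrass equations\<close>

context valuation
begin

abbreviation weq_ball :: "nat \<Rightarrow> 'a weq set" where
  "weq_ball m \<equiv> {E. divisible v (m, m, m, m, m) E}"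

lemma weq_ball_0: "weq_ball 0 = integral_weqs v"
  by (simp add: integral_weqs_def)

lemma divisible_zero: "divisible v (n1, n2, n3, n4, n6) 0"
  by (simp add: zero_prod_def)

lemma divisible_diff:
  "divisible v (n1, n2, n3, n4, n6) E \<Longrightarrow> divisible v (n1, n2, n3, n4, n6) F \<Longrightarrow>
    divisible v (n1, n2, n3, n4, n6) (E - F)"
  by (induct E rule: prod_induct5, induct F rule: prod_induct5) (simp add: ideal_diff)

lemma integral_add: "E \<in> integral_weqs v \<Longrightarrow> F \<in> integral_weqs v \<Longrightarrow> E + F \<in> integral_weqs v"
  by (induct E rule: prod_induct5, induct F rule: prod_induct5)
    (simp add: integral_weqs_iff ideal_add)

text \<open>The exponents may differ by coordinate: equal ones describe a ball, and
  \<open>(1, 2, 3, 4, 6)\<close> describes the image of scaling.\<close>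

lemma weq_residue_system:
  assumes "residue_system v n1 A1" "residue_system v n2 A2" "residue_system v n3 A3"
    "residue_system v n4 A4" "residue_system v n6 A6"
  defines "A \<equiv> A1 \<times> A2 \<times> A3 \<times> A4 \<times> A6"
  shows "finite A" "A \<subseteq> integral_weqs v" "card A = residue_card v ^ (n1 + n2 + n3 + n4 + n6)"
    and "E \<in> integral_weqs v \<Longrightarrow> \<exists>!a. a \<in> A \<and> divisible v (n1, n2, n3, n4, n6) (E - a)"
proof -
  note D = residue_systemD[OF assms(1)] residue_systemD[OF assms(2)] residue_systemD[OF assms(3)]
    residue_systemD[OF assms(4)] residue_systemD[OF assms(5)]
  show "finite A" using D by (simp add: A_def)
  show "A \<subseteq> integral_weqs v"
    using residue_systemD(2)[OF assms(1)] residue_systemD(2)[OF assms(2)]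
      residue_systemD(2)[OF assms(3)] residue_systemD(2)[OF assms(4)]
      residue_systemD(2)[OF assms(5)] by (auto simp: A_def integral_weqs_iff)
  show "card A = residue_card v ^ (n1 + n2 + n3 + n4 + n6)"
    using D by (simp add: A_def card_cartesian_product power_add)
  assume E: "E \<in> integral_weqs v"
  obtain e1 e2 e3 e4 e6 where EE: "E = (e1, e2, e3, e4, e6)" by (metis prod_cases5)
  have e: "e1 \<in> val_ring v" "e2 \<in> val_ring v" "e3 \<in> val_ring v" "e4 \<in> val_ring v" "e6 \<in> val_ring v"
    using E unfolding EE integral_weqs_iff by auto
  show "\<exists>!a. a \<in> A \<and> divisible v (n1, n2, n3, n4, n6) (E - a)"
  proof (rule ex_ex1I)
    obtain a1 where "a1 \<in> A1" "e1 - a1 \<in> val_ideal v n1"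
      using residue_systemD(4)[OF assms(1) e(1)] by blast
    moreover obtain a2 where "a2 \<in> A2" "e2 - a2 \<in> val_ideal v n2"
      using residue_systemD(4)[OF assms(2) e(2)] by blast
    moreover obtain a3 where "a3 \<in> A3" "e3 - a3 \<in> val_ideal v n3"
      using residue_systemD(4)[OF assms(3) e(3)] by blast
    moreover obtain a4 where "a4 \<in> A4" "e4 - a4 \<in> val_ideal v n4"
      using residue_systemD(4)[OF assms(4) e(4)] by blast
    moreover obtain a6 where "a6 \<in> A6" "e6 - a6 \<in> val_ideal v n6"
      using residue_systemD(4)[OF assms(5) e(5)] by blast
    ultimately show "\<exists>a. a \<in> A \<and> divisible v (n1, n2, n3, n4, n6) (E - a)"
      by (intro exI[of _ "(a1, a2, a3, a4, a6)"]) (simp add: A_def EE)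
  next
    fix a b
    assume ab: "a \<in> A \<and> divisible v (n1, n2, n3, n4, n6) (E - a)"
      "b \<in> A \<and> divisible v (n1, n2, n3, n4, n6) (E - b)"
    obtain a1 a2 a3 a4 a6 where a: "a = (a1, a2, a3, a4, a6)" by (metis prod_cases5)
    obtain b1 b2 b3 b4 b6 where b: "b = (b1, b2, b3, b4, b6)" by (metis prod_cases5)
    show "a = b" using ab unfolding a b EE A_def
      using residue_systemD(5)[OF assms(1) e(1)] residue_systemD(5)[OF assms(2) e(2)]
        residue_systemD(5)[OF assms(3) e(3)] residue_systemD(5)[OF assms(4) e(4)]
        residue_systemD(5)[OF assms(5) e(5)]
      by simp
  qed
qed

text \<open>For fixed \<open>r\<close>, \<open>s\<close>, \<open>t\<close> the change is affine in
  the coefficients, but not linear: the zero equation acquires the constant terms.\<close>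

lemma change_coords_affine:
  "change_coords 1 r s t (E + F) + change_coords 1 r s t 0 =
    change_coords 1 r s t E + change_coords 1 r s t F"
  by (induct E rule: prod_induct5, induct F rule: prod_induct5) (simp add: zero_prod_def algebra_simps)

text \<open>In the difference the constant terms cancel, leaving a linear map with integral
  coefficients. Continuity of the change follows.\<close>

lemma change_coords_weq_ball:
  assumes "r \<in> val_ring v" "s \<in> val_ring v" "t \<in> val_ring v" "E - F \<in> weq_ball m"
  shows "change_coords 1 r s t E - change_coords 1 r s t F \<in> weq_ball m"
proof -
  obtain e1 e2 e3 e4 e6 where E: "E = (e1, e2, e3, e4, e6)" by (metis prod_cases5)
  obtain f1 f2 f3 f4 f6 where F: "F = (f1, f2, f3, f4, f6)" by (metis prod_cases5)
  define d1 d2 d3 d4 d6 where "d1 = e1 - f1" "d2 = e2 - f2" "d3 = e3 - f3" "d4 = e4 - f4" "d6 = e6 - f6"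
  note d = this
  have mem: "d1 \<in> val_ideal v m" "d2 \<in> val_ideal v m" "d3 \<in> val_ideal v m" "d4 \<in> val_ideal v m"
    "d6 \<in> val_ideal v m" using assms(4) by (simp_all add: E F d)
  have "change_coords 1 r s t E - change_coords 1 r s t F =
    (d1, d2 - s * d1, d3 + r * d1, d4 - s * d3 + (2 * r) * d2 - (t + r * s) * d1,
     d6 + r * d4 + (r * r) * d2 - t * d3 - (r * t) * d1)"
    by (simp add: E F d algebra_simps power2_eq_square)
  thus ?thesis using assms(1-3) mem
    by (simp del: change_coords.simps) (intro conjI ideal_add ideal_diff ideal_mult_left ring_numeral; assumption)
qed

end

context uniformized_valuation
begin

lemma ideal_divide_p_power: 
  assumes "x \<in> val_ideal v (m + n)" "i \<le> n" shows "x / p ^ i \<in> val_ideal v m"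
  using p_power_mult_ideal_iff[of i "x / p ^ i" m] ideal_mono[OF assms(1), of "i + m"] assms(2) p_nonzero
  by simp

text \<open>The loss of 6 in the exponent is the largest weight, that of \<open>a6\<close>.\<close>

lemma unscale_weq_ball:
  assumes "E - F \<in> weq_ball (m + 6)"
  shows "change_coords p 0 0 0 E - change_coords p 0 0 0 F \<in> weq_ball m"
proof -
  have "x / p \<in> val_ideal v m \<and> x / p^2 \<in> val_ideal v m \<and> x / p^3 \<in> val_ideal v m \<and>
    x / p^4 \<in> val_ideal v m \<and> x / p^6 \<in> val_ideal v m" if "x \<in> val_ideal v (m + 6)" for x
    using that ideal_divide_p_power[of x m 6] ideal_divide_p_power[of x m 6 1] by auto
  thus ?thesis using assms
    by (induct E rule: prod_induct5, induct F rule: prod_induct5)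
      (simp flip: diff_divide_distrib)
qed

lemma scale_weq_ball:
  assumes "E - F \<in> weq_ball m"
  shows "scale_weq p E - scale_weq p F \<in> weq_ball m"
  using assms ideal_power[OF p_in_ring]
  by (induct E rule: prod_induct5, induct F rule: prod_induct5)
    (simp add: ideal_mult_left p_in_ring flip: right_diff_distrib)

lemma scale_weq_image: "scale_weq p ` integral_weqs v = {E. divisible v (1, 2, 3, 4, 6) E}"
proof
  show "scale_weq p ` integral_weqs v \<subseteq> {E. divisible v (1, 2, 3, 4, 6) E}"
    by (intro image_subsetI CollectI divisible_scale_weq) simp_all
  show "{E. divisible v (1, 2, 3, 4, 6) E} \<subseteq> scale_weq p ` integral_weqs v"
    using divisible_imp_scale_weq by blast
qed

end

section \<open>Topology of Weierstrass equations over a local field\<close>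

locale local_field = uniformized_valuation v p
  for v :: "'a::{field, metric_space} \<Rightarrow> int" and p :: 'a +
  assumes dist_eq: "dist x y = val_abs v (x - y)"
begin

text \<open>A base above 1 makes the absolute value strictly decreasing in the valuation, so that
  the ideals are balls of the metric. The value 0 is excluded because \<open>0 powi (-1) = 0\<close>
  would give \<open>p\<close> distance 0 from 0; the value 1 because 0 and 1 are
  incongruent.\<close>

lemma residue_card_gt_1: "residue_card v > 1"
proof -
  txt \<open>An infinite residue field has cardinality 0, for which \<open>val_abs\<close> does not give a metric.\<close>
  have "residue_card v \<noteq> 0"
  proof
    assume "residue_card v = 0"
    hence "dist p 0 = 0" using p_nonzero v_p by (simp add: dist_eq val_abs_def)
    thus False using p_nonzero by simp
  qed
  moreover have "residue_card v \<noteq> 1"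
  proof
    assume 1: "residue_card v = 1"
    then obtain A where A: "residue_system v 1 A" using residue_system_1 by auto
    then obtain a where a: "A = {a}" using residue_systemD(3)[OF A] 1 by (auto simp: card_1_singleton_iff)
    have "0 - a \<in> val_ideal v 1" "1 - a \<in> val_ideal v 1"
      using residue_systemD(4)[OF A ideal_zero] residue_systemD(4)[OF A ring_one] by (simp_all add: a)
    hence "(1 - a) - (0 - a) \<in> val_ideal v 1" using ideal_diff by blast
    thus False using one_notin_ideal by simp
  qed
  ultimately show ?thesis by simp
qed

lemma val_abs_le_iff: "val_abs v x \<le> real (residue_card v) powi (- int m) \<longleftrightarrow> x \<in> val_ideal v m"
proof -
  have "real (residue_card v) powi i \<le> real (residue_card v) powi j \<longleftrightarrow> i \<le> j" for i j
    using residue_card_gt_1 power_int_increasing[of i j "real (residue_card v)"]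
      power_int_strict_increasing[of j i "real (residue_card v)"]
    by (cases "i \<le> j") auto
  thus ?thesis by (auto simp: val_abs_def val_ideal_def)
qed

lemma ball_base_val_ideal: "ball_base (\<lambda>x m. {y :: 'a. y - x \<in> val_ideal v m})"
  unfolding ball_base_def
proof (intro conjI allI impI)
  fix x :: 'a and m
  let ?Q = "real (residue_card v)"
  show "open {y. y - x \<in> val_ideal v m}"
    unfolding open_dist
  proof (intro ballI exI[of _ "?Q powi (- int m)"] conjI allI impI)
    show "?Q powi (- int m) > 0" using residue_card_gt_1 by simp
    fix y z assume y: "y \<in> {y. y - x \<in> val_ideal v m}" and "dist z y < ?Q powi (- int m)"
    hence "z - y \<in> val_ideal v m" using val_abs_le_iff[of "z - y" m] by (simp add: dist_eq)
    thus "z \<in> {y. y - x \<in> val_ideal v m}" using ideal_add[of "z - y" m "y - x"] y by simp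
  qed
  show "x \<in> {y. y - x \<in> val_ideal v m}" by simp
  show "{y. y - x \<in> val_ideal v (Suc m)} \<subseteq> {y. y - x \<in> val_ideal v m}"
    using ideal_mono[of _ "Suc m" m] by auto
next
  fix U :: "'a set" and x assume "open U" "x \<in> U"
  then obtain e where e: "e > 0" "\<And>y. dist y x < e \<Longrightarrow> y \<in> U" unfolding open_dist by blast
  have "inverse (real (residue_card v)) < 1" using residue_card_gt_1 by (simp add: inverse_less_1_iff)
  then obtain m where m: "inverse (real (residue_card v)) ^ m < e"
    using real_arch_pow_inv[OF e(1)] by blast
  have "{y. y - x \<in> val_ideal v m} \<subseteq> U"
  proof
    fix y assume "y \<in> {y. y - x \<in> val_ideal v m}"
    hence "dist y x \<le> real (residue_card v) powi (- int m)" using val_abs_le_iff by (simp add: dist_eq)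
    thus "y \<in> U" using m by (intro e(2)) (simp add: power_int_minus power_inverse)
  qed
  thus "\<exists>m. {y. y - x \<in> val_ideal v m} \<subseteq> U" by blast
qed

lemma ball_base_weq_ball: "ball_base (\<lambda>E m. (+) E ` weq_ball m)"
proof -
  have "(+) (x1, x2, x3, x4, x6) ` weq_ball m =
    {y. y - x1 \<in> val_ideal v m} \<times> {y. y - x2 \<in> val_ideal v m} \<times> {y. y - x3 \<in> val_ideal v m} \<times>
    {y. y - x4 \<in> val_ideal v m} \<times> {y. y - x6 \<in> val_ideal v m}" for x1 x2 x3 x4 x6 m
  proof -
    have *: "E \<in> (+) (x1, x2, x3, x4, x6) ` weq_ball m \<longleftrightarrow> E - (x1, x2, x3, x4, x6) \<in> weq_ball m" for E
      by (auto intro: image_eqI[of _ _ "E - (x1, x2, x3, x4, x6)"])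
    show ?thesis
    proof (rule Set.set_eqI)
      fix E show "E \<in> (+) (x1, x2, x3, x4, x6) ` weq_ball m \<longleftrightarrow> E \<in> {y. y - x1 \<in> val_ideal v m} \<times>
        {y. y - x2 \<in> val_ideal v m} \<times> {y. y - x3 \<in> val_ideal v m} \<times>
        {y. y - x4 \<in> val_ideal v m} \<times> {y. y - x6 \<in> val_ideal v m}"
        unfolding * by (induct E rule: prod_induct5) simp
    qed
  qed
  hence "(\<lambda>E m. (+) E ` weq_ball m) = (\<lambda>(x1, x2, x3, x4, x6) m.
    {y. y - x1 \<in> val_ideal v m} \<times> {y. y - x2 \<in> val_ideal v m} \<times> {y. y - x3 \<in> val_ideal v m} \<times>
    {y. y - x4 \<in> val_ideal v m} \<times> {y. y - x6 \<in> val_ideal v m})"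
    by (auto simp: fun_eq_iff)
  thus ?thesis
    using ball_base_Times[OF ball_base_val_ideal ball_base_Times[OF ball_base_val_ideal
      ball_base_Times[OF ball_base_val_ideal ball_base_Times[OF ball_base_val_ideal ball_base_val_ideal]]]]
    by (simp add: case_prod_unfold)
qed

sublocale weq: ball_group weq_ball
proof
  fix m
  show "0 \<in> weq_ball m" using divisible_zero by simp
  show "x - y \<in> weq_ball m" if "x \<in> weq_ball m" "y \<in> weq_ball m" for x y
    using that divisible_diff by simp
  show "weq_ball (Suc m) \<subseteq> weq_ball m"
    using ideal_mono[of _ "Suc m" m] by auto
  show "open ((+) x ` weq_ball m)" for x
    using ball_base_weq_ball unfolding ball_base_def by blast
  show "\<exists>m. (+) x ` weq_ball m \<subseteq> U" if "open U" "x \<in> U" for U x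
    using ball_base_weq_ball that unfolding ball_base_def by blast
  obtain A where A: "residue_system v m A" using residue_system_exists residue_card_gt_1 by fastforce
  show "\<exists>A. finite A \<and> A \<subseteq> weq_ball 0 \<and> (\<forall>x\<in>weq_ball 0. \<exists>!a. a \<in> A \<and> x - a \<in> weq_ball m)"
    using weq_residue_system[OF A A A A A] unfolding weq_ball_0 mem_Collect_eq
    by (intro exI[of _ "A \<times> A \<times> A \<times> A \<times> A"]) simp
qed

lemma residue_systems: "\<exists>A. \<forall>i. residue_system v i (A i)"
  by (intro choice allI residue_system_exists) (use residue_card_gt_1 in simp)

lemma continuous_change_coords:
  assumes "r \<in> val_ring v" "s \<in> val_ring v" "t \<in> val_ring v"
  shows "continuous_on UNIV (change_coords 1 r s t)"
  using change_coords_weq_ball[OF assms] by (intro weq.continuous_onI_coset) blast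

lemma continuous_scale_weq: "continuous_on UNIV (scale_weq p)"
  using scale_weq_ball by (intro weq.continuous_onI_coset) blast

lemma continuous_unscale_weq: "continuous_on UNIV (change_coords p 0 0 0)"
  using unscale_weq_ball by (intro weq.continuous_onI_coset) blast

text \<open>Serves to pass measurability from the set for \<open>Suc k\<close> back to the one for
  \<open>k\<close>.\<close>

lemma vimage_scale_weq_borel:
  assumes "S \<in> sets borel"
  shows "scale_weq p -` S \<in> sets borel"
  using measurable_sets[OF borel_measurable_continuous_onI[OF continuous_scale_weq] assms] by simp

lemma integral_weqs_borel: "integral_weqs v \<in> sets borel"
  using weq.open_V[of 0] unfolding weq_ball_0 by simp

section \<open>Transformation of Haar measure and the recursion for the densities\<close>

context
  fixes M :: "'a weq measure"
  assumes haar: "haar_measure M" and normalized_measure: "emeasure M (integral_weqs v) = 1"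
begin

lemma sets_haar: "sets M = sets borel"
  using haar unfolding haar_measure_def by (rule conjunct1)

lemma haar_translate: "A \<in> sets borel \<Longrightarrow> emeasure M ((+) x ` A) = emeasure M A"
  using haar[unfolded haar_measure_def, THEN conjunct2, THEN conjunct1] by (elim allE) (rule bspec)

lemma emeasure_weq_ball_0: "emeasure M (weq_ball 0) = 1"
  unfolding weq_ball_0 by (rule normalized_measure)

text \<open>An integral change has an integral inverse, so it maps the integral equations onto
  themselves; the transversal is \<open>{0}\<close> and the factor is 1.\<close>

lemma emeasure_change_coords:
  assumes R: "r \<in> val_ring v" "s \<in> val_ring v" "t \<in> val_ring v"
    and S: "S \<in> sets borel" "S \<subseteq> integral_weqs v"
  shows "change_coords 1 r s t ` S \<in> sets borel"
    "emeasure M (change_coords 1 r s t ` S) = emeasure M S"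
proof -
  let ?f = "change_coords 1 r s t" and ?g = "change_coords 1 (- r) (- s) (s * r - t)"
  have R': "- r \<in> val_ring v" "- s \<in> val_ring v" "s * r - t \<in> val_ring v"
    using R by (auto intro!: ideal_intros)
  have gf: "?g (?f E) = E" and fg: "?f (?g E) = E" for E
    by (simp_all add: change_coords_change_coords del: change_coords.simps)
  have onto: "E \<in> ?f ` weq_ball 0" if "E \<in> weq_ball 0" for E
  proof -
    have "?f (?g E) \<in> ?f ` weq_ball 0"
      using change_coords_integral[OF that[unfolded weq_ball_0] R'] unfolding weq_ball_0 by (rule imageI)
    thus ?thesis unfolding fg .
  qed
  have unique: "\<exists>!c. c \<in> {0} \<and> E - c \<in> ?f ` weq_ball 0" if "E \<in> weq_ball 0" for E
    using onto[OF that]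
    by (intro ex1I[of _ 0]) (simp_all only: singleton_iff diff_zero simp_thms)
  have sub: "c + ?f E \<in> weq_ball 0" if "c \<in> {0}" "E \<in> weq_ball 0" for c E
    using that change_coords_integral[OF _ R, of E] unfolding weq_ball_0
    by (simp only: singleton_iff add_0)
  have fin: "finite {0 :: 'a weq}" by simp
  have SV: "S \<subseteq> weq_ball 0" using S(2) unfolding weq_ball_0 .
  note * = weq.emeasure_affine_image[where f = ?f and g = ?g and C = "{0}", OF sets_haar
    haar_translate emeasure_weq_ball_0 change_coords_affine gf fg
    continuous_change_coords[OF R'] fin sub unique S(1) SV]
  show "?f ` S \<in> sets borel" by (rule *)
  show "emeasure M (?f ` S) = emeasure M S" using *(2) by simp
qed

text \<open>The image of the integral equations has index \<open>Q^16\<close>, where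
  \<open>16 = 1 + 2 + 3 + 4 + 6\<close>.\<close>

lemma emeasure_scale_weq:
  assumes S: "S \<in> sets borel" "S \<subseteq> integral_weqs v"
  shows "scale_weq p ` S \<in> sets borel"
    "emeasure M S = of_nat (residue_card v ^ 16) * emeasure M (scale_weq p ` S)"
proof -
  let ?f = "scale_weq p" and ?g = "change_coords p 0 0 0"
  obtain A where "\<forall>i. residue_system v i (A i)" using residue_systems by (elim exE)
  note this[rule_format]
  note A = weq_residue_system[OF this[of 1] this[of 2] this[of 3] this[of 4] this[of 6]]
  let ?A = "A 1 \<times> A 2 \<times> A 3 \<times> A 4 \<times> A 6"
  have image: "?f ` weq_ball 0 = {E. divisible v (1, 2, 3, 4, 6) E}"
    unfolding weq_ball_0 by (rule scale_weq_image)
  have unique: "\<exists>!c. c \<in> ?A \<and> E - c \<in> ?f ` weq_ball 0" if "E \<in> weq_ball 0" for E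
  proof -
    have "E \<in> integral_weqs v" using that unfolding weq_ball_0 .
    from A(4)[OF this] show ?thesis by (simp only: image mem_Collect_eq)
  qed
  have sub: "c + ?f E \<in> weq_ball 0" if "c \<in> ?A" "E \<in> weq_ball 0" for c E
    using that A(2) scale_weq_integral integral_add unfolding weq_ball_0 by blast
  have SV: "S \<subseteq> weq_ball 0" using S(2) unfolding weq_ball_0 .
  note * = weq.emeasure_affine_image[where f = ?f and g = ?g and C = ?A, OF sets_haar
    haar_translate emeasure_weq_ball_0 scale_weq_add
    change_coords_scale_weq_inverse(1)[OF p_nonzero] change_coords_scale_weq_inverse(2)[OF p_nonzero]
    continuous_unscale_weq A(1) sub unique S(1) SV]
  show "?f ` S \<in> sets borel" by (rule *)
  show "emeasure M S = of_nat (residue_card v ^ 16) * emeasure M (?f ` S)"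
    using *(2) unfolding A(3) by simp
qed

text \<open>There are \<open>Q^6\<close> disjoint pieces, and \<open>Q^16\<close> times the measure
  of each is that of \<open>S k\<close>. The multiplicative form avoids division in the extended
  reals.\<close>

lemma local_density_Suc:
  "local_density v p M T n k = real (residue_card v) ^ 10 * local_density v p M T n (Suc k)"
proof -
  define S where "S k = {E \<in> integral_weqs v. weq_disc E \<noteq> 0 \<and> tate v p E k T \<and>
    tamagawa_number v E = n}" for k
  define tau where "tau = (\<lambda>(r, s, t). change_coords (1::'a) r s t)"
  have S_sub: "S k \<subseteq> integral_weqs v" by (auto simp: S_def)
  have S_change: "F \<in> S k" if "E \<in> S k" "integral_change v E F" for E F
  proof -
    have "tate v p F k T"
      by (rule tate_transfer[OF _ integral_change_sym[OF that(2)]]) (use that(1) in \<open>simp add: S_def\<close>)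
    thus ?thesis
      using that integral_change_integral[OF that(2)] integral_change_weq_disc[OF that(2)]
        tamagawa_number_isomorphic[OF integral_change_isomorphic[OF that(2)], of v]
      by (simp add: S_def)
  qed
  have S_Suc: "E \<in> S (Suc k) \<longleftrightarrow> E \<in> integral_weqs v \<and> (\<exists>F\<in>S k. integral_change v E (scale_weq p F))"
    for E
  proof -
    have same: "weq_disc E \<noteq> 0 \<longleftrightarrow> weq_disc F \<noteq> 0" "tamagawa_number v E = tamagawa_number v F"
      if EF: "integral_change v E (scale_weq p F)" for F
    proof -
      show "weq_disc E \<noteq> 0 \<longleftrightarrow> weq_disc F \<noteq> 0"
        using integral_change_weq_disc[OF EF] p_nonzero by (auto simp: weq_disc_scale_weq)
      show "tamagawa_number v E = tamagawa_number v F"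
        by (rule tamagawa_number_isomorphic, rule isomorphic_weq_trans,
          rule integral_change_isomorphic[OF EF], rule isomorphic_weq_sym,
          rule isomorphic_scale_weq[OF p_nonzero])
    qed
    show ?thesis
    proof
      assume "E \<in> S (Suc k)"
      hence E: "E \<in> integral_weqs v" "weq_disc E \<noteq> 0" "tate v p E (Suc k) T" "tamagawa_number v E = n"
        unfolding S_def by simp_all
      obtain F where F: "F \<in> integral_weqs v" "integral_change v E (scale_weq p F)" "tate v p F k T"
        using E(3) unfolding tate_Suc_iff by (elim bexE conjE)
      have "F \<in> S k" using F E same[OF F(2)] by (simp add: S_def)
      thus "E \<in> integral_weqs v \<and> (\<exists>F\<in>S k. integral_change v E (scale_weq p F))"
        using E(1) F(2) by blast
    next
      assume "E \<in> integral_weqs v \<and> (\<exists>F\<in>S k. integral_change v E (scale_weq p F))"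
      then obtain F where E: "E \<in> integral_weqs v" and F: "F \<in> S k" "integral_change v E (scale_weq p F)"
        by (elim bexE conjE)
      have "tate v p E (Suc k) T" unfolding tate_Suc_iff using F by (auto simp: S_def)
      thus "E \<in> S (Suc k)" using E F(1) same[OF F(2)] by (simp add: S_def)
    qed
  qed
  \<comment> \<open>Ensures that \<open>S (Suc k)\<close> is not Borel when \<open>S k\<close> is
    not, so that both measures are then 0.\<close>
  have vimage: "S k = scale_weq p -` S (Suc k) \<inter> integral_weqs v"
  proof (intro equalityI subsetI)
    fix E assume E: "E \<in> S k"
    hence "E \<in> integral_weqs v" using S_sub by blast
    moreover from this have "scale_weq p E \<in> S (Suc k)"
      unfolding S_Suc using E
      by (intro conjI bexI[of _ E] scale_weq_integral integral_change_refl)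
    ultimately show "E \<in> scale_weq p -` S (Suc k) \<inter> integral_weqs v" by simp
  next
    fix E assume "E \<in> scale_weq p -` S (Suc k) \<inter> integral_weqs v"
    hence E: "E \<in> integral_weqs v"
      and ex: "\<exists>F\<in>S k. integral_change v (scale_weq p E) (scale_weq p F)"
      unfolding Int_iff vimage_eq S_Suc by blast+
    from ex obtain F where F: "F \<in> S k"
      and EF: "integral_change v (scale_weq p E) (scale_weq p F)" by (elim bexE)
    from EF obtain r s t where "scale_weq p F = change_coords 1 r s t (scale_weq p E)"
      unfolding integral_change_def by (elim bexE)
    from integral_change_scale_weq_imp(4)[OF E subsetD[OF S_sub F] this]
    have "integral_change v F E" by (rule integral_change_sym)
    with F show "E \<in> S k" by (rule S_change)
  qed
  obtain A where A: "\<forall>i. residue_system v i (A i)" using residue_systems by (elim exE)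
  note D = residue_systemD[OF A[rule_format]]
  \<comment> \<open>Classes of \<open>r\<close> modulo \<open>p^2\<close>, of \<open>s\<close>
    modulo \<open>p\<close> and of \<open>t\<close> modulo \<open>p^3\<close>, in the order of the
    triple.\<close>
  let ?G = "A 2 \<times> A 1 \<times> A 3"
  have G_ring: "r \<in> val_ring v" "s \<in> val_ring v" "t \<in> val_ring v" if "(r, s, t) \<in> ?G" for r s t
    using that D(2)[of 1] D(2)[of 2] D(2)[of 3] by auto
  have decomposition: "S (Suc k) = (\<Union>g\<in>?G. tau g ` scale_weq p ` S k)"
  proof (intro equalityI subsetI)
    fix E assume "E \<in> S (Suc k)"
    hence "\<exists>F\<in>S k. integral_change v E (scale_weq p F)" unfolding S_Suc by (rule conjunct2)
    then obtain F where F: "F \<in> S k" and EF: "integral_change v E (scale_weq p F)" by (elim bexE)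
    obtain r s t where R: "r \<in> val_ring v" "s \<in> val_ring v" "t \<in> val_ring v"
      and E: "E = change_coords 1 r s t (scale_weq p F)"
      using integral_change_sym[OF EF] unfolding integral_change_def by (elim bexE)
    obtain r' where r': "r' \<in> A 2" "r - r' \<in> val_ideal v 2" using D(4)[OF R(1), of 2] by blast
    obtain s' where s': "s' \<in> A 1" "s - s' \<in> val_ideal v 1" using D(4)[OF R(2), of 1] by blast
    \<comment> \<open>The composition law contributes \<open>(s - s') * r'\<close> to the last
      parameter, so this is subtracted before the representative \<open>t'\<close> is
      chosen.\<close>
    have "t - (s - s') * r' \<in> val_ring v"
      by (intro ideal_diff ideal_mult_left R(3) ideal_ring[OF s'(2)] subsetD[OF D(2) r'(1)])
    from D(4)[OF this, of 3] obtain t' where t': "t' \<in> A 3" "t - (s - s') * r' - t' \<in> val_ideal v 3"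
      by blast
    obtain F' where F': "integral_change v F F'"
      "change_coords 1 (r - r') (s - s') (t - (s - s') * r' - t') (scale_weq p F) = scale_weq p F'"
      using integral_change_scale_weq[OF r'(2) s'(2) t'(2), of F] by (elim exE conjE)
    have "E = change_coords 1 r' s' t' (scale_weq p F')"
      unfolding E F'(2)[symmetric]
      by (simp add: change_coords_change_coords algebra_simps del: change_coords.simps)
    hence "E = tau (r', s', t') (scale_weq p F')" by (simp add: tau_def del: change_coords.simps)
    moreover have "(r', s', t') \<in> ?G" using r'(1) s'(1) t'(1) by simp
    ultimately show "E \<in> (\<Union>g\<in>?G. tau g ` scale_weq p ` S k)"
      using S_change[OF F F'(1)] by (intro UN_I[of "(r', s', t')"] image_eqI[OF _ imageI])
  next
    fix E assume "E \<in> (\<Union>g\<in>?G. tau g ` scale_weq p ` S k)"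
    then obtain g F where g: "g \<in> ?G" and F: "F \<in> S k" and E: "E = tau g (scale_weq p F)"
      by (elim UN_E imageE) simp
    obtain r s t where gg: "g = (r, s, t)" by (metis prod_cases3)
    have FE: "integral_change v (scale_weq p F) E"
      unfolding integral_change_def using G_ring[OF g[unfolded gg]]
      by (intro bexI[of _ r] bexI[of _ s] bexI[of _ t])
        (simp_all only: E gg tau_def prod.case)
    have "E \<in> integral_weqs v"
      using integral_change_integral[OF FE scale_weq_integral[OF subsetD[OF S_sub F]]] .
    thus "E \<in> S (Suc k)" unfolding S_Suc using F integral_change_sym[OF FE] \<open>E \<in> integral_weqs v\<close>
      by (intro conjI bexI[of _ F])
  qed
  have disjoint: "disjoint_family_on (\<lambda>g. tau g ` scale_weq p ` S k) ?G"
    unfolding disjoint_family_on_def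
  proof (intro ballI impI)
    fix g g' assume g: "g \<in> ?G" "g' \<in> ?G" and "g \<noteq> g'"
    show "tau g ` scale_weq p ` S k \<inter> tau g' ` scale_weq p ` S k = {}"
    proof (rule ccontr)
      assume "tau g ` scale_weq p ` S k \<inter> tau g' ` scale_weq p ` S k \<noteq> {}"
      then obtain F F' where F: "F \<in> S k" "F' \<in> S k"
        and eq: "tau g (scale_weq p F) = tau g' (scale_weq p F')"
        unfolding ex_in_conv[symmetric] Int_iff by (elim exE conjE imageE) simp
      obtain r s t where gg: "g = (r, s, t)" by (metis prod_cases3)
      obtain r' s' t' where gg': "g' = (r', s', t')" by (metis prod_cases3)
      have eq': "change_coords 1 r' s' t' (scale_weq p F') = change_coords 1 r s t (scale_weq p F)"
        using eq by (simp only: gg gg' tau_def prod.case)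
      \<comment> \<open>Applying the inverse of the second change to a common element expresses one
        scaled equation as a change of the other; the differences of the parameters then lie in the
        ideals.\<close>
      have "scale_weq p F' =
        change_coords 1 (- r') (- s') (s' * r' - t') (change_coords 1 r' s' t' (scale_weq p F'))"
        by (simp add: change_coords_change_coords del: change_coords.simps)
      also have "\<dots> = change_coords 1 (r - r') (s - s') (t - t' - (s - s') * r') (scale_weq p F)"
        unfolding eq' by (simp add: change_coords_change_coords algebra_simps del: change_coords.simps)
      finally have *: "scale_weq p F' =
        change_coords 1 (r - r') (s - s') (t - t' - (s - s') * r') (scale_weq p F)" .
      note I = integral_change_scale_weq_imp[OF subsetD[OF S_sub F(1)] subsetD[OF S_sub F(2)] *]
      have mem: "r \<in> A 2" "r' \<in> A 2" "s \<in> A 1" "s' \<in> A 1" "t \<in> A 3" "t' \<in> A 3"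
        using g unfolding gg gg' by simp_all
      note unique = residue_systemD(5)[OF A[rule_format] _ _ _ _, OF subsetD[OF D(2)]]
      have "r = r'" using unique[OF mem(1) mem(1,2)] I(1) by simp
      moreover have "s = s'" using unique[OF mem(3) mem(3,4)] I(2) by simp
      \<comment> \<open>The correction term vanishes only after \<open>s = s'\<close> is
        known.\<close>
      moreover have "t = t'" using unique[OF mem(5) mem(5,6)] I(3) \<open>s = s'\<close> by simp
      ultimately show False using \<open>g \<noteq> g'\<close> gg gg' by simp
    qed
  qed
  show ?thesis
  proof (cases "S k \<in> sets borel")
    case True
    note scale = emeasure_scale_weq[OF True S_sub]
    have scale_sub: "scale_weq p ` S k \<subseteq> integral_weqs v"
      using scale_weq_integral S_sub by blast
    have tau: "tau g ` scale_weq p ` S k \<in> sets borel"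
      "emeasure M (tau g ` scale_weq p ` S k) = emeasure M (scale_weq p ` S k)" if "g \<in> ?G" for g
    proof -
      obtain r s t where gg: "g = (r, s, t)" by (metis prod_cases3)
      note * = emeasure_change_coords[OF G_ring[OF that[unfolded gg]] scale(1) scale_sub]
      show "tau g ` scale_weq p ` S k \<in> sets borel" using *(1) by (simp add: gg tau_def)
      show "emeasure M (tau g ` scale_weq p ` S k) = emeasure M (scale_weq p ` S k)"
        using *(2) by (simp add: gg tau_def)
    qed
    have "emeasure M (S (Suc k)) = (\<Sum>g\<in>?G. emeasure M (tau g ` scale_weq p ` S k))"
      unfolding decomposition using tau(1) D(1) sets_haar
      by (intro sum_emeasure[symmetric] disjoint) auto
    also have "\<dots> = of_nat (card ?G) * emeasure M (scale_weq p ` S k)" by (simp add: tau(2))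
    also have "card ?G = residue_card v ^ 6" by (simp add: card_cartesian_product D(3) eval_nat_numeral)
    \<comment> \<open>The exponent 10 is chosen so that \<open>10 + 6 = 16\<close> matches the
      scaling factor.\<close>
    finally have "of_nat (residue_card v ^ 10) * emeasure M (S (Suc k)) =
      of_nat (residue_card v ^ 10) * of_nat (residue_card v ^ 6) * emeasure M (scale_weq p ` S k)"
      by (simp add: mult.assoc)
    also have "\<dots> = emeasure M (S k)" unfolding scale(2) by (simp flip: power_add)
    finally have "emeasure M (S k) = of_nat (residue_card v ^ 10) * emeasure M (S (Suc k))" ..
    hence "measure M (S k) = real (residue_card v) ^ 10 * measure M (S (Suc k))"
      by (simp add: measure_def enn2real_mult flip: of_nat_power)
    thus ?thesis by (simp add: local_density_def S_def)
  next
    txt \<open>The measure of a set that is not measurable is 0 by convention.\<close>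
    case False
    moreover from this have "S (Suc k) \<notin> sets borel"
      using sets.Int[OF vimage_scale_weq_borel integral_weqs_borel, of "S (Suc k)"]
      unfolding vimage[symmetric] by blast
    ultimately have "measure M (S k) = 0" "measure M (S (Suc k)) = 0"
      using sets_haar by (simp_all add: measure_notin_sets)
    thus ?thesis by (simp add: local_density_def S_def)
  qed
qed

lemma local_density_eq:
  "local_density v p M T n k = 1 / real (residue_card v) ^ (10 * k) * local_density v p M T n 0"
proof (induction k)
  case (Suc k)
  have "real (residue_card v) ^ 10 * local_density v p M T n (Suc k) =
    1 / real (residue_card v) ^ (10 * k) * local_density v p M T n 0"
    using Suc local_density_Suc[of T n k] by (rule trans[OF sym, rotated])
  hence "local_density v p M T n (Suc k) =
      1 / (real (residue_card v) ^ 10 * real (residue_card v) ^ (10 * k)) * local_density v p M T n 0"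
    using residue_card_gt_1 by (simp add: divide_simps mult_ac)
  thus ?case by (simp only: power_add[symmetric] mult_Suc_right)
qed simp

end

end

theorem theorem1p2:
  fixes i :: "'q::{finite, field} poly fract \<Rightarrow> 'k::field"
    and v :: "'k \<Rightarrow> int"
    and e :: "'k \<Rightarrow> 'l::{field, complete_space}"
    and w :: "'l \<Rightarrow> int"
    and \<pi> :: 'l
    and \<mu> :: "('l \<times> 'l \<times> 'l \<times> 'l \<times> 'l) measure"
    and T :: kodaira and n k :: nat
  assumes "finite_field_extension i"
    and "normalized_valuation v"
    and "is_completion v e w"
    and "\<pi> \<noteq> 0" and "w \<pi> = 1"
    and "haar_measure \<mu>" and "emeasure \<mu> (integral_weqs w) = 1"
    and "n \<ge> 1"
  shows "local_density w \<pi> \<mu> T n k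
       = 1 / real (residue_card w) ^ (10 * k) * local_density w \<pi> \<mu> T n 0"
proof -
  interpret local_field w \<pi>
    using assms(3-5) by unfold_locales (auto simp: is_completion_def)
  show ?thesis using assms(6,7) by (rule local_density_eq)
qed

end
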